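(* Let $$\mathcal{G}(t;x,u,v,q,z)=\sum_{n=1}^{\infty}t^n\sum_{\pi\in\mathfrak{S}_n}\frac{u^{\mathsf{des}(\pi)}x^{\mathsf{ides}(\pi)}q^{\mathsf{lmin}(\pi)}v^{\mathsf{rmax}(\pi)}z^{\mathsf{lmax}(\pi)}}{(1-u)^n(1-x)^n}.$$ The generating function $\mathcal{G}(t;x,u,v,1,1)$ of permutations with respect to the triple $(\mathsf{des},\mathsf{ides},\mathsf{rmax})$, or equivalently $(\mathsf{des},\mathsf{ides},\mathsf{lmin})$, $(\mathsf{ides},\mathsf{des},\mathsf{lmin})$ or $(\mathsf{ides},\mathsf{des},\mathsf{rmax})$, satisfies both $$\mathcal{G}(t;x,u,v,1,1)=\sum_{n=1}^{\infty}\frac{vt\,u^{n-1}}{(1-t)^n-x}\prod_{i=1}^{n-1}\frac{x-(1-t)^i-xvt}{x-(1-t)^i}$$ and $$\mathcal{G}(t;x,u,v,1,1)=\sum_{n=1}^{\infty}\frac{vt(1-t)^{n-1}}{u^{n}\big(x(1-t)^{n-1}-1\big)}\prod_{i=1}^{n}\frac{1-x(1-t)^{i-1}}{x(1-t)^{i-1}(vt-1)+1}.$$ Furthermore, $\mathcal{G}(t;x,u,v,1,1)=\mathcal{G}(t;u,x,1,v,1)=\mathcal{G}(t;x,u,1,v,1)=\mathcal{G}(t;u,x,v,1,1)$.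
   Context: $\mathfrak{S}_n$ is the set of permutations $\pi=\pi_1\pi_2\cdots\pi_n$ of $[n]=\{1,\dots,n\}$. $\mathsf{des}(\pi)=|\{i\in[n-1]:\pi_i>\pi_{i+1}\}|$; $\mathsf{ides}(\pi)=\mathsf{des}(\pi^{-1})$; $\mathsf{lmax}(\pi)=|\{\pi_i:\pi_i>\pi_j\text{ for all }j<i\}|$; $\mathsf{lmin}(\pi)=|\{\pi_i:\pi_i<\pi_j\text{ for all }j<i\}|$; $\mathsf{rmax}(\pi)=|\{\pi_i:\pi_i>\pi_j\text{ for all }j>i\}|$. Empty products equal $1$. The coefficient of each power of $t$ in $\mathcal{G}(t;x,u,v,1,1)$ is a rational function of $x,u$ (polynomial in $v$). The first formula is an identity of formal power series in $u$ with coefficients in $\mathbb{Q}[v][[x,t]]$ (expand $\mathcal G$ in nonnegative powers of $u$); the second is an identity of formal power series in $u^{-1}$ with coefficients in $\mathbb{Q}[v][[x,t]]$ (expand the rational functions of $u$ occurring in $\mathcal G$ in powers of $u^{-1}$). *)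

theory Defs
  imports
    "HOL-Computational_Algebra.Computational_Algebra"
    "HOL-Combinatorics.Permutations"
begin

section \<open>Permutation statistics\<close>

text \<open>
  A permutation of \<open>[n]\<close> is a function \<open>p :: nat \<Rightarrow> nat\<close> with \<open>p permutes {1..n}\<close>,
  so that \<open>p i\<close> is the \<open>i\<close>-th letter of its one-line notation.
\<close>

definition des :: "nat \<Rightarrow> (nat \<Rightarrow> nat) \<Rightarrow> nat" where
  "des n p = card {i \<in> {1..n - 1}. p i > p (i + 1)}"

definition ides :: "nat \<Rightarrow> (nat \<Rightarrow> nat) \<Rightarrow> nat" where
  "ides n p = des n (inv p)"

definition lmax :: "nat \<Rightarrow> (nat \<Rightarrow> nat) \<Rightarrow> nat" where
  "lmax n p = card {p i |i. i \<in> {1..n} \<and> (\<forall>j \<in> {1..n}. j < i \<longrightarrow> p i > p j)}"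

definition lmin :: "nat \<Rightarrow> (nat \<Rightarrow> nat) \<Rightarrow> nat" where
  "lmin n p = card {p i |i. i \<in> {1..n} \<and> (\<forall>j \<in> {1..n}. j < i \<longrightarrow> p i < p j)}"

definition rmax :: "nat \<Rightarrow> (nat \<Rightarrow> nat) \<Rightarrow> nat" where
  "rmax n p = card {p i |i. i \<in> {1..n} \<and> (\<forall>j \<in> {1..n}. j > i \<longrightarrow> p i > p j)}"


section \<open>The generating function\<close>

text \<open>
  The formal power series in \<open>t\<close> whose coefficients are the given rational expressions in
  \<open>x, u, v, q, z\<close>, evaluated in an arbitrary field. With \<open>x, u, v\<close> indeterminates of a field
  of rational functions, this is the generating function itself; with \<open>x, u\<close> the
  corresponding elements of a field of Laurent series, every coefficient is expanded in
  that field.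
\<close>

definition perm_gf :: "'a::field \<Rightarrow> 'a \<Rightarrow> 'a \<Rightarrow> 'a \<Rightarrow> 'a \<Rightarrow> 'a fps" where
  "perm_gf x u v q z = Abs_fps (\<lambda>n. if n = 0 then 0 else
     (\<Sum>p | p permutes {1..n}.
        (u ^ des n p * x ^ ides n p * q ^ lmin n p * v ^ rmax n p * z ^ lmax n p) /
        ((1 - u) ^ n * (1 - x) ^ n)))"


section \<open>Indeterminates of the rings involved\<close>

text \<open>
  The field of rational functions over the rationals in \<open>x\<close>, \<open>u\<close>, \<open>v\<close>: the fraction field of
  \<open>\<rat>[v][x][u]\<close>.
\<close>

type_synonym ratfun = "rat poly poly poly fract"

definition rat_v :: ratfun where "rat_v = Fract [:[:[:0, 1:]:]:] 1"
definition rat_x :: ratfun where "rat_x = Fract [:[:0, 1:]:] 1"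
definition rat_u :: ratfun where "rat_u = Fract [:0, 1:] 1"

text \<open>
  Scalars of all series below are rational functions in \<open>v\<close>. (The type class hierarchy
  provides inverses of power series only over rings carrying an inverse operation, hence
  \<open>\<rat>(v)\<close> rather than \<open>\<rat>[v]\<close>.)
\<close>

type_synonym scal = "rat poly fract"

definition scal_v :: scal where "scal_v = Fract [:0, 1:] 1"

text \<open>
  Iterated Laurent series \<open>\<rat>(v)((x))((y))\<close>, where \<open>y\<close>, called \<open>fls_X\<close>, stands for \<open>u\<close> or
  for \<open>u\<^sup>-\<^sup>1\<close>, depending on the expansion.
\<close>

type_synonym lau = "scal fls fls"

definition lau_v :: lau where "lau_v = fls_const (fls_const scal_v)"
definition lau_x :: lau where "lau_x = fls_const fls_X"
definition lau_y :: lau where "lau_y = fls_X"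

text \<open>
  Power series in \<open>y\<close> with coefficients in \<open>\<rat>(v)[[x,t]]\<close>, the latter being represented as
  \<open>\<rat>(v)[[x]][[t]]\<close>. As \<open>y\<close> is the outermost variable, convergence in this type is
  \<open>y\<close>-adic. A quotient whose denominator has a nonzero constant term in \<open>\<rat>(v)\<close> is the
  true quotient, as such a series is a unit.
\<close>

type_synonym ser = "scal fps fps fps"

definition ser_v :: ser where "ser_v = fps_const (fps_const (fps_const scal_v))"
definition ser_x :: ser where "ser_x = fps_const (fps_const fps_X)"
definition ser_t :: ser where "ser_t = fps_const fps_X"
definition ser_y :: ser where "ser_y = fps_X"

text \<open>
  The series \<open>g\<close> in \<open>t\<close> over \<open>\<rat>(v)((x))((y))\<close> has no negative powers of \<open>x\<close> and \<open>y\<close>, and it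
  agrees with \<open>h\<close> after regrouping by powers of \<open>y\<close>: for all \<open>n\<close> and \<open>k\<close>, the coefficient of
  \<open>t\<^sup>n y\<^sup>k\<close> is the same. At most one \<open>h\<close> is thus related to a given \<open>g\<close>.
\<close>

definition expands_to :: "lau fps \<Rightarrow> ser \<Rightarrow> bool" where
  "expands_to g h \<longleftrightarrow>
     (\<forall>n. fps_nth g n =
        fps_to_fls (Abs_fps (\<lambda>k. fps_to_fls (fps_nth (fps_nth h k) n))))"

end

theory Submission
  imports Defs
begin

text \<open>
  Expanding \<open>x\<^bsup>ides+1\<^esup>/(1-x)\<^bsup>n+1\<^esup>\<close> turns pairs of a permutation and a labelling into words over
  \<open>{1..l}\<close> (standardization preserves descents and right-to-left maxima), and expanding
  \<open>u\<^bsup>des+1\<^esup>/(1-u)\<^bsup>n+1\<^esup>\<close> cuts such a word into \<open>k\<close> weakly increasing blocks. Let \<open>V k m\<close> be the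
  series in \<open>t\<close> of words cut into \<open>k\<close> blocks with largest letter \<open>m\<close>. A new first block
  contributes a right-to-left maximum exactly if its last letter exceeds all later letters, so
  \<open>V (k+1) m = (1-t)\<^bsup>-m\<^esup> (V k m + vt \<Sum>m'<m. V k m')\<close>. For \<open>Z k = \<Sum>m. V k m x\<^bsup>m\<^esup>\<close> this gives
  \<open>Z (k+1) ((1-t)\<^bsup>k+1\<^esup> - x) = Z k ((1-t)\<^bsup>k+1\<^esup> - x + xvt)\<close>, which is the product of the first formula; the
  coefficient of \<open>u\<^bsup>k\<^esup>\<close> in the generating function is \<open>(Z (k+1) - Z k)/x\<close>. Expanding in \<open>u\<^bsup>-1\<^esup>\<close>
  instead leads to strictly decreasing blocks with \<open>-t\<close> in place of \<open>t\<close>, and to the second formula.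
  The symmetries come from inversion and from reverse-complementation.
\<close>

section \<open>Symmetries of the statistics\<close>

lemma lmin_positions:
  assumes "p permutes {1..n}"
  shows "lmin n p = card {i \<in> {1..n}. \<forall>j \<in> {1..n}. j < i \<longrightarrow> p i < p j}" (is "_ = card ?P")
proof -
  have "{p i |i. i \<in> {1..n} \<and> (\<forall>j \<in> {1..n}. j < i \<longrightarrow> p i < p j)} = p ` ?P" by auto
  thus ?thesis unfolding lmin_def
    by (metis (no_types, lifting) assms card_image permutes_inj_on)
qed

lemma rmax_positions:
  assumes "p permutes {1..n}"
  shows "rmax n p = card {i \<in> {1..n}. \<forall>j \<in> {1..n}. j > i \<longrightarrow> p i > p j}" (is "_ = card ?P")
proof -
  have "{p i |i. i \<in> {1..n} \<and> (\<forall>j \<in> {1..n}. j > i \<longrightarrow> p i > p j)} = p ` ?P" by auto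
  thus ?thesis unfolding rmax_def
    by (metis (no_types, lifting) assms card_image permutes_inj_on)
qed

text \<open>Position i is a right-to-left maximum exactly if no point of the graph lies both to the
  right of and above (i, p i). Reflection in the diagonal preserves this condition, so
  \<open>p\<close> carries the positions for \<open>p\<close> to those for
  \<open>inv p\<close>.\<close>

lemma rmax_inv:
  assumes p: "p permutes {1..n}"
  shows "rmax n (inv p) = rmax n p"
proof -
  let ?P = "{i \<in> {1..n}. \<forall>j \<in> {1..n}. j > i \<longrightarrow> p i > p j}"
  let ?Q = "{i \<in> {1..n}. \<forall>j \<in> {1..n}. j > i \<longrightarrow> inv p i > inv p j}"
  have inj: "inj p" and inv: "\<And>i. p (inv p i) = i" "\<And>i. inv p (p i) = i"
    using p by (auto simp: permutes_inj permutes_inverses)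
  have "?Q = p ` ?P"
  proof (intro set_eqI iffI)
    fix i assume i: "i \<in> ?Q"
    have "inv p i \<in> ?P"
    proof (clarsimp, intro conjI ballI impI)
      have "inv p i \<in> {1..n}" using i by (simp only: permutes_in_image[OF permutes_inv[OF p]]) auto
      thus "Suc 0 \<le> inv p i" "inv p i \<le> n" by auto
      fix j assume j: "j \<in> {Suc 0..n}" "inv p i < j"
      have pj: "p j \<in> {1..n}" using j p by (subst permutes_in_image) auto
      have "\<not> i < p j" using i pj j inv(2)[of j] by auto
      moreover have "i \<noteq> p j" using j inv by auto
      ultimately show "p j < p (inv p i)" by (simp add: inv)
    qed
    thus "i \<in> p ` ?P" using inv(1)[of i] by (metis (no_types, lifting) imageI)
  next
    fix i assume "i \<in> p ` ?P"
    then obtain a where a: "a \<in> ?P" "i = p a" by auto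
    show "i \<in> ?Q"
    proof (clarsimp, intro conjI ballI impI)
      have "i \<in> {1..n}" using a p by (simp only: permutes_in_image) auto
      thus "Suc 0 \<le> i" "i \<le> n" by auto
      fix j assume j: "j \<in> {Suc 0..n}" "i < j"
      have pj: "inv p j \<in> {1..n}" using j p by (subst permutes_in_image[OF permutes_inv]) auto
      have "\<not> a < inv p j" using a pj j inv(1)[of j] by auto
      moreover have "a \<noteq> inv p j" using j a inv by auto
      ultimately show "inv p j < inv p i" by (simp add: inv a)
    qed
  qed
  moreover have "card (p ` ?P) = card ?P"
    by (rule card_image) (rule permutes_inj_on[OF p])
  ultimately show ?thesis
    by (simp only: rmax_positions[OF p] rmax_positions[OF permutes_inv[OF p]])
qed

section \<open>The half turn of the permutation matrix\<close>

definition rev_perm :: "nat \<Rightarrow> nat \<Rightarrow> nat" where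
  "rev_perm n i = (if i \<in> {1..n} then n + 1 - i else i)"

lemma rev_perm_rev_perm [simp]: "rev_perm n (rev_perm n i) = i"
  by (auto simp: rev_perm_def)

lemma rev_perm_comp [simp]: "rev_perm n \<circ> rev_perm n = id"
  by (simp add: fun_eq_iff)

lemma rev_perm_permutes: "rev_perm n permutes {1..n}"
  unfolding permutes_def by (metis rev_perm_def rev_perm_rev_perm)

lemma inv_rev_perm: "inv (rev_perm n) = rev_perm n"
  by (rule inv_unique_comp) simp_all

text \<open>A half turn of the graph. It keeps descents, commutes with inversion and so keeps
  inverse descents, and turns right-to-left maxima into left-to-right minima.\<close>

definition rev_compl :: "nat \<Rightarrow> (nat \<Rightarrow> nat) \<Rightarrow> (nat \<Rightarrow> nat)" where
  "rev_compl n p = rev_perm n \<circ> p \<circ> rev_perm n"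

lemma rev_compl_permutes:
  "p permutes {1..n} \<Longrightarrow> rev_compl n p permutes {1..n}"
  unfolding rev_compl_def by (intro permutes_compose rev_perm_permutes)

lemma rev_compl_rev_compl: "rev_compl n (rev_compl n p) = p"
  by (simp add: rev_compl_def fun_eq_iff)

lemma inv_rev_compl:
  assumes "p permutes {1..n}"
  shows "inv (rev_compl n p) = rev_compl n (inv p)"
proof -
  have "bij p" "bij (rev_perm n)" using assms rev_perm_permutes permutes_bij by blast+
  thus ?thesis
    by (simp add: rev_compl_def o_inv_distrib bij_comp inv_rev_perm comp_assoc)
qed

lemma rev_compl_eq:
  assumes "p permutes {1..n}" "i \<in> {1..n}"
  shows "rev_compl n p i = n + 1 - p (n + 1 - i)"
proof -
  have "p (n + 1 - i) \<in> {1..n}" using assms(2) by (subst permutes_in_image[OF assms(1)]) auto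
  thus ?thesis using assms(2) by (simp add: rev_compl_def rev_perm_def)
qed

lemma permutes_bounds:
  assumes "p permutes {1..n}" "i \<in> {1..n}"
  shows "1 \<le> p i" "p i \<le> n"
  using permutes_in_image[OF assms(1), of i] assms(2) by auto

lemma des_rev_compl:
  assumes p: "p permutes {1..n}"
  shows "des n (rev_compl n p) = des n p"
proof -
  \<comment> \<open>The positions i, i + 1 go to n + 1 - i, n - i, and complementing the values
    undoes the reversal of their order; hence a descent at i becomes one at n - i.\<close>
  have "bij_betw (\<lambda>i. n - i) {i \<in> {1..n - 1}. p i > p (i + 1)}
     {i \<in> {1..n - 1}. rev_compl n p i > rev_compl n p (i + 1)}" (is "bij_betw _ ?P ?Q")
  proof (rule bij_betw_byWitness[where f' = "\<lambda>i. n - i"])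
    have "rev_compl n p (Suc (n - i)) < rev_compl n p (n - i)"
      if i: "p (Suc i) < p i" "Suc 0 \<le> i" "i \<le> n - Suc 0" for i
    proof -
      have "Suc (n - i) \<in> {1..n}" "n - i \<in> {1..n}" using i by auto
      note e = this[THEN rev_compl_eq[OF p]]
      have "p i \<le> n" using permutes_bounds[OF p, of i] i by auto
      moreover have "n + 1 - Suc (n - i) = i" "n + 1 - (n - i) = Suc i" using i by auto
      ultimately show ?thesis unfolding e using i by simp
    qed
    thus "(\<lambda>i. n - i) ` ?P \<subseteq> ?Q"
      by auto
    have "p (Suc (n - i)) < p (n - i)"
      if i: "rev_compl n p (Suc i) < rev_compl n p i" "Suc 0 \<le> i" "i \<le> n - Suc 0" for i
    proof -
      have "Suc i \<in> {1..n}" "i \<in> {1..n}" using i by auto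
      note e = this[THEN rev_compl_eq[OF p]]
      have "n + 1 - i = Suc (n - i)" using i by auto
      thus ?thesis using i unfolding e by simp
    qed
    thus "(\<lambda>i. n - i) ` ?Q \<subseteq> ?P"
      by auto
  qed auto
  thus ?thesis unfolding des_def by (simp add: bij_betw_same_card)
qed

lemma lmin_rev_compl:
  assumes p: "p permutes {1..n}"
  shows "lmin n (rev_compl n p) = rmax n p"
proof -
  have "bij_betw (\<lambda>i. n + 1 - i) {i \<in> {1..n}. \<forall>j \<in> {1..n}. j > i \<longrightarrow> p i > p j}
     {i \<in> {1..n}. \<forall>j \<in> {1..n}. j < i \<longrightarrow> rev_compl n p i < rev_compl n p j}"
    (is "bij_betw _ ?P ?Q")
  proof (rule bij_betw_byWitness[where f' = "\<lambda>i. n + 1 - i"])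
    show "(\<lambda>i. n + 1 - i) ` ?P \<subseteq> ?Q"
    proof (rule image_subsetI)
      fix i assume "i \<in> ?P"
      hence i: "Suc 0 \<le> i" "i \<le> n" "\<forall>j\<in>{Suc 0..n}. i < j \<longrightarrow> p j < p i" by auto
      have "rev_compl n p (Suc n - i) < rev_compl n p j"
        if j: "Suc 0 \<le> j" "j \<le> n" "j < Suc n - i" for j
      proof -
      have "Suc n - i \<in> {1..n}" "j \<in> {1..n}" using i j by auto
      note e = this[THEN rev_compl_eq[OF p]]
      have "Suc n - j \<in> {Suc 0..n}" "i < Suc n - j" using i j by auto
      hence "p (Suc n - j) < p i" using i(3) by blast
      moreover have "p i \<le> n" using permutes_bounds[OF p, of i] i by auto
      moreover have "Suc n - (Suc n - i) = i" using i by simp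
      ultimately show ?thesis unfolding e by simp
      qed
      thus "n + 1 - i \<in> ?Q" using i by auto
    qed
    show "(\<lambda>i. n + 1 - i) ` ?Q \<subseteq> ?P"
    proof (rule image_subsetI)
      fix i assume "i \<in> ?Q"
      hence i: "Suc 0 \<le> i" "i \<le> n"
        "\<forall>j\<in>{Suc 0..n}. j < i \<longrightarrow> rev_compl n p i < rev_compl n p j" by auto
      have "p j < p (Suc n - i)" if j: "Suc 0 \<le> j" "j \<le> n" "Suc n - i < j" for j
      proof -
      have "Suc n - j \<in> {1..n}" "i \<in> {1..n}" using i j by auto
      note e = this[THEN rev_compl_eq[OF p]]
      have "Suc n - j \<in> {Suc 0..n}" "Suc n - j < i" using i j by auto
      hence "rev_compl n p i < rev_compl n p (Suc n - j)" using i(3) by blast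
      moreover have "Suc n - (Suc n - j) = j" using j by simp
      ultimately show ?thesis unfolding e by simp
      qed
      thus "n + 1 - i \<in> ?P" using i by auto
    qed
  qed auto
  thus ?thesis
    by (simp only: rmax_positions[OF p] lmin_positions[OF rev_compl_permutes[OF p]] bij_betw_same_card)
qed

lemma perm_gf_rev_compl: "perm_gf x u 1 v 1 = perm_gf x u v 1 1"
proof -
  have "(\<Sum>p | p permutes {1..n}. u ^ des n p * x ^ ides n p * v ^ rmax n p / ((1 - u) ^ n * (1 - x) ^ n)) =
    (\<Sum>p | p permutes {1..n}. u ^ des n p * x ^ ides n p * v ^ lmin n p / ((1 - u) ^ n * (1 - x) ^ n))" for n
    by (rule sum.reindex_bij_witness[where i = "rev_compl n" and j = "rev_compl n"])
      (simp_all add: ides_def des_rev_compl inv_rev_compl lmin_rev_compl rev_compl_rev_compl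
        rev_compl_permutes permutes_inv del: One_nat_def)
  thus ?thesis by (simp add: perm_gf_def del: One_nat_def cong: if_cong)
qed

lemma perm_gf_inv: "perm_gf u x v 1 1 = perm_gf x u v 1 1"
proof -
  have "(\<Sum>p | p permutes {1..n}. x ^ des n p * u ^ ides n p * v ^ rmax n p / ((1 - x) ^ n * (1 - u) ^ n)) =
    (\<Sum>p | p permutes {1..n}. u ^ des n p * x ^ ides n p * v ^ rmax n p / ((1 - u) ^ n * (1 - x) ^ n))" for n
    by (rule sum.reindex_bij_witness[where i = inv and j = inv])
      (simp_all add: ides_def rmax_inv permutes_inv_inv permutes_inv mult_ac del: One_nat_def)
  thus ?thesis by (simp add: perm_gf_def del: One_nat_def cong: if_cong)
qed

section \<open>Words cut into sorted blocks\<close>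

text \<open>
  The number of ways to cut \<open>w\<close> into \<open>k\<close> possibly empty consecutive blocks, each sorted with
  respect to the transitive relation \<open>R\<close>: the first block is empty, or it consists of \<open>a\<close> alone,
  or \<open>a\<close> may be put in front of the first block of the rest.
\<close>

fun blocks :: "(nat \<Rightarrow> nat \<Rightarrow> bool) \<Rightarrow> nat \<Rightarrow> nat list \<Rightarrow> nat" where
  "blocks R k [] = 1"
| "blocks R 0 (a # w) = 0"
| "blocks R (Suc k) (a # w) =
     blocks R k (a # w) + blocks R (if w \<noteq> [] \<and> R a (hd w) then Suc k else k) w"

text \<open>These are the places at which every cutting into \<open>R\<close>-sorted blocks must
  cut.\<close>

definition breaks :: "(nat \<Rightarrow> nat \<Rightarrow> bool) \<Rightarrow> nat list \<Rightarrow> nat" where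
  "breaks R w = length (filter (\<lambda>(a, b). \<not> R a b) (zip w (tl w)))"

lemma breaks_simps [simp]:
  "breaks R [] = 0" "breaks R [a] = 0"
  "breaks R (a # b # w) = (if R a b then 0 else 1) + breaks R (b # w)"
  by (simp_all add: breaks_def)

text \<open>The recursion of \<open>blocks\<close> runs letter by letter; here the first block is
  removed at once. By transitivity, a letter fits in front of a sorted block as soon as it fits its
  head.\<close>

lemma blocks_Suc:
  assumes "transp R"
  shows "blocks R (Suc k) w =
    (\<Sum>i | i \<le> length w \<and> sorted_wrt R (take i w). blocks R k (drop i w))"
proof (induction w)
  case (Cons a w)
  have "{i. i \<le> length (a # w) \<and> sorted_wrt R (take i (a # w))} =
      insert 0 (Suc ` {i. i \<le> length w \<and> sorted_wrt R (a # take i w)})" (is "?A = insert 0 (Suc ` ?B)")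
  proof (intro set_eqI)
    fix i show "i \<in> ?A \<longleftrightarrow> i \<in> insert 0 (Suc ` ?B)"
      by (cases i) auto
  qed
  hence "(\<Sum>i | i \<le> length (a # w) \<and> sorted_wrt R (take i (a # w)). blocks R k (drop i (a # w))) =
      blocks R k (a # w) + (\<Sum>i\<in>?B. blocks R k (drop i w))"
    by (simp add: sum.reindex)
  also have "(\<Sum>i\<in>?B. blocks R k (drop i w)) =
      blocks R (if w \<noteq> [] \<and> R a (hd w) then Suc k else k) w"
  proof (cases "w \<noteq> [] \<and> R a (hd w)")
    case True
    have "sorted_wrt R (a # take i w) \<longleftrightarrow> sorted_wrt R (take i w)" for i
    proof (cases "take i w")
      case (Cons b u)
      hence "b = hd w" using True by (cases w; cases i) auto
      thus ?thesis using Cons True assms by (auto dest: transpD)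
    qed auto
    thus ?thesis using True by (simp add: Cons.IH)
  next
    case False
    have "sorted_wrt R (a # take i w) \<longleftrightarrow> i = 0" if "i \<le> length w" for i
      using False that by (cases w; cases i) auto
    hence "?B = {0}" by auto
    thus ?thesis using False by auto
  qed
  finally show ?case by simp
qed simp

lemma fps_one_minus_X_mult_nth:
  "((1 - fps_X) * (f :: 'a::comm_ring_1 fps)) $ n = (if n = 0 then f $ 0 else f $ n - f $ (n - 1))"
  by (simp add: algebra_simps)

text \<open>Multiplication by 1 - X removes the cuttings whose first block is empty. Each letter
  thus costs one factor 1 - X and yields X if a break follows it or it is the last letter, and 1
  otherwise. The remaining factor 1 - X belongs to the empty word.\<close>

lemma blocks_gf:
  "(1 - fps_X) ^ Suc (length w) * Abs_fps (\<lambda>k. of_nat (blocks R k w)) =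
    (if w = [] then 1 else fps_X ^ Suc (breaks R w) :: 'a::comm_ring_1 fps)"
proof (induction w)
  case Nil
  show ?case by (simp add: fps_eq_iff fps_one_minus_X_mult_nth)
next
  case (Cons a w)
  let ?G = "\<lambda>w. Abs_fps (\<lambda>k. of_nat (blocks R k w)) :: 'a fps"
  have "(1 - fps_X) * ?G (a # w) = (if w \<noteq> [] \<and> R a (hd w) then 1 else fps_X) * ?G w"
  proof (rule fps_ext)
    fix n show "((1 - fps_X) * ?G (a # w)) $ n =
        ((if w \<noteq> [] \<and> R a (hd w) then 1 else fps_X) * ?G w) $ n"
      by (cases n; cases w) (auto simp: fps_one_minus_X_mult_nth)
  qed
  note step = this
  have "(1 - fps_X) ^ Suc (length (a # w)) * ?G (a # w) =
    (1 - fps_X) ^ Suc (length w) * ((1 - fps_X) * ?G (a # w))"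
    by (simp only: power_Suc2 list.size add_0_right add_Suc_right mult.assoc)
  also have "\<dots> =
    (if w \<noteq> [] \<and> R a (hd w) then 1 else fps_X) * ((1 - fps_X) ^ Suc (length w) * ?G w)"
    unfolding step by (rule mult.left_commute)
  also have "\<dots> = fps_X ^ Suc (breaks R (a # w))"
    unfolding Cons.IH by (cases w) auto
  finally show ?case by simp
qed

section \<open>Words by largest letter, and their right-to-left maxima\<close>

definition max_letter :: "nat list \<Rightarrow> nat" where
  "max_letter w = foldr max w 0"

lemma max_letter_simps [simp]:
  "max_letter [] = 0" "max_letter (a # w) = max a (max_letter w)"
  "max_letter (u @ w) = max (max_letter u) (max_letter w)"
  by (induction u) (simp_all add: max_letter_def)

lemma max_letter_drop_le: "max_letter (drop i w) \<le> max_letter w"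
  by (metis append_take_drop_id max_letter_simps(3) max.cobounded2)

lemma max_letter_le_iff: "max_letter w \<le> m \<longleftrightarrow> (\<forall>a\<in>set w. a \<le> m)"
  by (induction w) auto

lemma max_letter_less_iff: "max_letter w < m \<longleftrightarrow> 0 < m \<and> (\<forall>a\<in>set w. a < m)"
  by (induction w) auto

lemma max_letter_in_set: "w \<noteq> [] \<Longrightarrow> max_letter w \<in> set w"
proof (induction w)
  case (Cons a w)
  thus ?case by (cases "w = []") (auto simp: max_def)
qed simp

text \<open>Here \<open>c\<close> stands for the largest letter of whatever follows: only the
  right-to-left maxima above \<open>c\<close> survive in the longer word.\<close>

fun rmax_above :: "nat \<Rightarrow> nat list \<Rightarrow> nat" where
  "rmax_above c [] = 0"
| "rmax_above c (a # w) = (if max_letter w < a \<and> c < a then 1 else 0) + rmax_above c w"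

lemma rmax_above_append:
  "rmax_above 0 (u @ w) = rmax_above (max_letter w) u + rmax_above 0 w"
  by (induction u) auto

lemma rmax_above_eq_0: "max_letter w \<le> c \<Longrightarrow> rmax_above c w = 0"
  by (induction w) auto

lemma rmax_above_snoc:
  "max_letter w \<le> m \<Longrightarrow> rmax_above c (w @ [m]) = (if 0 < m \<and> c < m then 1 else 0)"
  by (induction w) auto

text \<open>With positive letters, the largest letter 0 singles out the empty word.\<close>

definition words :: "nat \<Rightarrow> nat \<Rightarrow> nat list set" where
  "words n m = {w. length w = n \<and> 0 \<notin> set w \<and> max_letter w = m}"

definition sorted_words :: "(nat \<Rightarrow> nat \<Rightarrow> bool) \<Rightarrow> nat \<Rightarrow> nat \<Rightarrow> nat list set" where
  "sorted_words R n m = {w \<in> words n m. sorted_wrt R w}"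

lemma finite_words [simp]: "finite (words n m)"
  by (rule finite_subset[OF _ finite_lists_length_eq[of "{..m}" n]])
    (auto simp: words_def max_letter_le_iff[THEN iffD1, OF order.refl])

lemma finite_sorted_words [simp]: "finite (sorted_words R n m)"
  by (simp add: sorted_words_def)

lemma words_0_left: "words 0 m = (if m = 0 then {[]} else {})"
  by (auto simp: words_def)

lemma words_0_right: "words n 0 = (if n = 0 then {[]} else {})"
proof -
  have "w = []" if "0 \<notin> set w" "max_letter w = 0" for w
    using that max_letter_in_set[of w] by auto
  thus ?thesis by (auto simp: words_def)
qed

text \<open>
  The series variable is \<open>t\<close>. The sign \<open>s\<close> is \<open>1\<close> for weakly increasing and \<open>-1\<close> for strictly
  decreasing blocks; it comes from \<open>(1 - 1/y)\<^sup>n = (-1)\<^sup>n (1 - y)\<^sup>n / y\<^sup>n\<close>.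
\<close>

definition word_gf :: "(nat \<Rightarrow> nat \<Rightarrow> bool) \<Rightarrow> 'a::comm_ring_1 \<Rightarrow> 'a \<Rightarrow> nat \<Rightarrow> nat \<Rightarrow> 'a fps" where
  "word_gf R s v k m = Abs_fps (\<lambda>n. s ^ n *
     (\<Sum>w\<in>words n m. v ^ rmax_above 0 w * of_nat (blocks R k w)))"

definition block_gf :: "(nat \<Rightarrow> nat \<Rightarrow> bool) \<Rightarrow> 'a::comm_ring_1 \<Rightarrow> 'a \<Rightarrow> nat \<Rightarrow> nat \<Rightarrow> 'a fps" where
  "block_gf R s v c m = Abs_fps (\<lambda>n. s ^ n * (\<Sum>w\<in>sorted_words R n m. v ^ rmax_above c w))"

text \<open>For m' \<le> m, the series of the blocks that turn a word with largest letter m' into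
  one with largest letter m when placed in front. If m' = m, the block may have any largest letter
  up to m; otherwise m has to come from the block.\<close>

definition transfer :: "(nat \<Rightarrow> nat \<Rightarrow> bool) \<Rightarrow> 'a::comm_ring_1 \<Rightarrow> 'a \<Rightarrow> nat \<Rightarrow> nat \<Rightarrow> 'a fps" where
  "transfer R s v m' m = (if m' = m then \<Sum>j\<le>m. block_gf R s v m j else block_gf R s v m' m)"

section \<open>Removing the first block\<close>

lemma word_gf_0: "word_gf R s v 0 m = (if m = 0 then 1 else 0)"
proof (rule fps_ext)
  fix n
  have "(\<Sum>w\<in>words n m. v ^ rmax_above 0 w * of_nat (blocks R 0 w)) = (0::'a)" if "n \<noteq> 0"
  proof (rule sum.neutral, safe)
    fix w assume "w \<in> words n m"
    thus "v ^ rmax_above 0 w * of_nat (blocks R 0 w) = (0::'a)"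
      using that by (cases w) (auto simp: words_def)
  qed
  thus "word_gf R s v 0 m $ n = (if m = 0 then 1 else 0) $ n"
    by (cases "n = 0") (auto simp: word_gf_def words_0_left)
qed

lemma sum_UN_sorted_words:
  "(\<Sum>w\<in>(\<Union>j\<le>m. sorted_words R n j). g w) = (\<Sum>j\<le>m. \<Sum>w\<in>sorted_words R n j. g w)"
  by (rule sum.UNION_disjoint) (simp, simp, auto simp: sorted_words_def words_def)

lemma transfer_nth:
  assumes "m' \<le> m"
  shows "transfer R s v m' m $ n = s ^ n *
    (\<Sum>u | length u = n \<and> 0 \<notin> set u \<and> sorted_wrt R u \<and> max (max_letter u) m' = m. v ^ rmax_above m' u)"
proof (cases "m' = m")
  case True
  have eq: "{u. length u = n \<and> 0 \<notin> set u \<and> sorted_wrt R u \<and> max (max_letter u) m = m} =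
      (\<Union>j\<le>m. sorted_words R n j)"
    by (auto simp: sorted_words_def words_def)
  thus ?thesis using True
    by (simp add: transfer_def eq sum_UN_sorted_words block_gf_def fps_sum_nth sum_distrib_left)
next
  case False
  have eq: "{u. length u = n \<and> 0 \<notin> set u \<and> sorted_wrt R u \<and> max (max_letter u) m' = m} =
      sorted_words R n m"
    using assms False by (auto simp: sorted_words_def words_def max_def)
  thus ?thesis using False by (simp add: transfer_def eq block_gf_def)
qed

text \<open>A word cut into \<open>Suc k\<close> blocks consists of a sorted first block
  \<open>u\<close> and a rest \<open>w\<close> cut into \<open>k\<close> blocks. The right-to-left
  maxima of \<open>u @ w\<close> are those of \<open>w\<close> and those of \<open>u\<close> above
  \<open>max_letter w\<close>, so the weight factors once the largest letter m' of the rest is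
  fixed.\<close>

lemma word_gf_Suc:
  assumes "transp R"
  shows "word_gf R s v (Suc k) m = (\<Sum>m'\<le>m. transfer R s v m' m * word_gf R s v k m')"
proof (rule fps_ext)
  fix n
  define U where "U = (\<lambda>i m'. {u. length u = i \<and> 0 \<notin> set u \<and> sorted_wrt R u \<and>
    max (max_letter u) m' = m})"
  have fin: "finite (U i m')" for i m'
    by (rule finite_subset[OF _ finite_lists_length_eq[of "{..m}" i]])
      (use max_letter_le_iff in \<open>fastforce simp: U_def\<close>)+
  define g where "g = (\<lambda>i w. v ^ rmax_above 0 w * of_nat (blocks R k (drop i w)))"
  have "(\<Sum>w\<in>words n m. v ^ rmax_above 0 w * of_nat (blocks R (Suc k) w)) =
      (\<Sum>w\<in>words n m. \<Sum>i\<in>{..n}. if sorted_wrt R (take i w) then g i w else 0)"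
  proof (rule sum.cong[OF refl])
    fix w assume w: "w \<in> words n m"
    have "{i. i \<le> length w \<and> sorted_wrt R (take i w)} = {i \<in> {..n}. sorted_wrt R (take i w)}"
      using w by (auto simp: words_def)
    thus "v ^ rmax_above 0 w * of_nat (blocks R (Suc k) w) =
        (\<Sum>i\<in>{..n}. if sorted_wrt R (take i w) then g i w else 0)"
      unfolding blocks_Suc[OF assms] of_nat_sum sum_distrib_left g_def
      by (simp only:) (rule sum.inter_filter, simp)
  qed
  also have "\<dots> = (\<Sum>i\<le>n. \<Sum>w\<in>{w \<in> words n m. sorted_wrt R (take i w)}. g i w)"
    by (subst sum.swap) (intro sum.cong refl sum.inter_filter[symmetric] finite_words)
  also have "\<dots> = (\<Sum>i\<le>n. \<Sum>m'\<le>m. \<Sum>u\<in>U i m'. \<Sum>w\<in>words (n - i) m'. g i (u @ w))"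
  proof (rule sum.cong[OF refl])
    fix i assume i: "i \<in> {..n}"
    have "(\<Sum>w\<in>{w \<in> words n m. sorted_wrt R (take i w)}. g i w) =
      (\<Sum>(m', u, w)\<in>(SIGMA m':{..m}. U i m' \<times> words (n - i) m'). g i (u @ w))"
      by (rule sum.reindex_bij_witness
          [where i = "\<lambda>(m', u, w). u @ w" and j = "\<lambda>w. (max_letter (drop i w), take i w, drop i w)"])
        (use i in \<open>auto simp: U_def words_def simp flip: max_letter_simps(3)
           dest: in_set_takeD in_set_dropD intro: max_letter_drop_le\<close>)
    also have "\<dots> = (\<Sum>m'\<le>m. \<Sum>(u, w)\<in>U i m' \<times> words (n - i) m'. g i (u @ w))"
      by (subst sum.Sigma) (auto simp: fin)
    finally show "(\<Sum>w\<in>{w \<in> words n m. sorted_wrt R (take i w)}. g i w) =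
       (\<Sum>m'\<le>m. \<Sum>u\<in>U i m'. \<Sum>w\<in>words (n - i) m'. g i (u @ w))"
      by (simp add: sum.cartesian_product)
  qed
  also have "\<dots> = (\<Sum>i\<le>n. \<Sum>m'\<le>m. (\<Sum>u\<in>U i m'. v ^ rmax_above m' u) *
      (\<Sum>w\<in>words (n - i) m'. v ^ rmax_above 0 w * of_nat (blocks R k w)))"
    unfolding sum_product
    by (intro sum.cong refl)
      (auto simp: g_def U_def words_def rmax_above_append power_add mult_ac)
  finally have "word_gf R s v (Suc k) m $ n = (\<Sum>i\<le>n. \<Sum>m'\<le>m. s ^ n * ((\<Sum>u\<in>U i m'. v ^ rmax_above m' u) *
      (\<Sum>w\<in>words (n - i) m'. v ^ rmax_above 0 w * of_nat (blocks R k w))))"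
    unfolding word_gf_def fps_nth_Abs_fps by (simp only:) (simp only: sum_distrib_left[of "s ^ n"])
  also have "\<dots> = (\<Sum>i\<le>n. \<Sum>m'\<le>m. transfer R s v m' m $ i * word_gf R s v k m' $ (n - i))"
  proof (intro sum.cong refl)
    fix i m' assume i: "i \<in> {..n}" and m': "m' \<in> {..m}"
    have "s ^ n = s ^ i * s ^ (n - i)" using i by (simp flip: power_add)
    thus "s ^ n * ((\<Sum>u\<in>U i m'. v ^ rmax_above m' u) *
      (\<Sum>w\<in>words (n - i) m'. v ^ rmax_above 0 w * of_nat (blocks R k w))) =
      transfer R s v m' m $ i * word_gf R s v k m' $ (n - i)"
      using m' by (simp add: transfer_nth word_gf_def U_def mult_ac)
  qed
  also have "\<dots> = (\<Sum>m'\<le>m. transfer R s v m' m * word_gf R s v k m') $ n"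
    by (subst sum.swap) (simp add: fps_sum_nth fps_mult_nth atMost_atLeast0)
  finally show "word_gf R s v (Suc k) m $ n = (\<Sum>m'\<le>m. transfer R s v m' m * word_gf R s v k m') $ n" .
qed

section \<open>Series of a single sorted block\<close>

lemma block_gf_0: "block_gf R s v c 0 = 1"
proof (rule fps_ext)
  fix n
  have "sorted_words R n 0 = (if n = 0 then {[]} else {})"
    by (auto simp: sorted_words_def words_0_right)
  thus "block_gf R s v c 0 $ n = 1 $ n" by (simp add: block_gf_def)
qed

lemma block_gf_cong_above: "m \<le> c \<Longrightarrow> m \<le> c' \<Longrightarrow> block_gf R s v c m = block_gf R s v c' m"
  by (auto simp: block_gf_def fps_eq_iff sorted_words_def words_def rmax_above_eq_0)

lemma const_X_const_mult_nth:
  "(fps_const s * fps_X * fps_const w * F) $ Suc i = s * w * (F $ i :: 'a::comm_ring_1)"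
  by (simp add: mult.assoc)

text \<open>A weakly increasing word with largest letter \<open>Suc m\<close> ends in it, and this
  last letter is its only right-to-left maximum. Removing it leaves any weakly increasing word with
  letters up to \<open>Suc m\<close>, unweighted because of the threshold \<open>Suc m\<close> on
  the right.\<close>

lemma block_gf_le_Suc:
  "block_gf (\<le>) s v c (Suc m) = fps_const s * fps_X * fps_const (if c \<le> m then v else 1) *
     (\<Sum>j\<le>Suc m. block_gf (\<le>) s v (Suc m) j)"
proof (rule fps_ext)
  fix n
  show "block_gf (\<le>) s v c (Suc m) $ n = (fps_const s * fps_X * fps_const (if c \<le> m then v else 1) *
     (\<Sum>j\<le>Suc m. block_gf (\<le>) s v (Suc m) j)) $ n"
  proof (cases n)
    case 0
    thus ?thesis by (simp add: block_gf_def sorted_words_def words_0_left mult.assoc)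
  next
    case (Suc i)
    have "(\<Sum>w\<in>sorted_words (\<le>) (Suc i) (Suc m). v ^ rmax_above c w) =
        (\<Sum>w\<in>(\<Union>j\<le>Suc m. sorted_words (\<le>) i j). (if c \<le> m then v else 1))"
    proof (rule sum.reindex_bij_witness[where i = "\<lambda>w. w @ [Suc m]" and j = butlast])
      fix w assume w: "w \<in> sorted_words (\<le>) (Suc i) (Suc m)"
      then obtain u a where u: "w = u @ [a]" by (cases w rule: rev_cases) (auto simp: sorted_words_def words_def)
      have "a = Suc m" using w
        by (auto simp: u sorted_words_def words_def sorted_wrt_append max_def max_letter_le_iff[symmetric] split: if_splits)
      note u = u[unfolded this]
      show "butlast w @ [Suc m] = w" by (simp add: u)
      have "max_letter u \<le> Suc m" using w by (auto simp: u sorted_words_def words_def)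
      thus "(if c \<le> m then v else 1) = v ^ rmax_above c w"
        by (simp add: u rmax_above_snoc)
      show "butlast w \<in> (\<Union>j\<le>Suc m. sorted_words (\<le>) i j)"
        using w by (auto simp: u sorted_words_def words_def sorted_wrt_append)
    next
      fix w assume w: "w \<in> (\<Union>j\<le>Suc m. sorted_words (\<le>) i j)"
      show "butlast (w @ [Suc m]) = w" by simp
      show "w @ [Suc m] \<in> sorted_words (\<le>) (Suc i) (Suc m)" using w
        by (auto simp: sorted_words_def words_def sorted_wrt_append simp flip: max_letter_le_iff)
    qed
    moreover have "(\<Sum>w\<in>sorted_words (\<le>) i j. v ^ rmax_above (Suc m) w) = (\<Sum>w\<in>sorted_words (\<le>) i j. 1)"
      if "j \<le> Suc m" for j
      by (rule sum.cong) (use that in \<open>auto simp: sorted_words_def words_def rmax_above_eq_0\<close>)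
    hence "(\<Sum>j\<le>Suc m. block_gf (\<le>) s v (Suc m) j) $ i =
        (\<Sum>j\<le>Suc m. s ^ i * (\<Sum>w\<in>sorted_words (\<le>) i j. 1))"
      unfolding block_gf_def fps_sum_nth by (intro sum.cong refl) simp
    moreover have "(\<Sum>j\<le>Suc m. \<Sum>w\<in>sorted_words (\<le>) i j. v) =
        v * (\<Sum>j\<le>Suc m. \<Sum>w\<in>sorted_words (\<le>) i j. 1)"
      by (simp only: sum_distrib_left mult_1_right)
    ultimately show ?thesis
      unfolding Suc const_X_const_mult_nth sum_UN_sorted_words
      by (simp add: block_gf_def mult_ac del: sum.atMost_Suc sum_constant flip: sum_distrib_left)
  qed
qed

text \<open>A strictly decreasing word begins with its largest letter, which is a right-to-left
  maximum. The rest has letters up to \<open>m\<close> and keeps its weight, so the threshold stays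
  \<open>c\<close>.\<close>

lemma block_gf_gt_Suc:
  "block_gf (>) s v c (Suc m) = fps_const s * fps_X * fps_const (if c \<le> m then v else 1) *
     (\<Sum>j\<le>m. block_gf (>) s v c j)"
proof (rule fps_ext)
  fix n
  show "block_gf (>) s v c (Suc m) $ n = (fps_const s * fps_X * fps_const (if c \<le> m then v else 1) *
     (\<Sum>j\<le>m. block_gf (>) s v c j)) $ n"
  proof (cases n)
    case 0
    thus ?thesis by (simp add: block_gf_def sorted_words_def words_0_left mult.assoc)
  next
    case (Suc i)
    have "(\<Sum>w\<in>sorted_words (>) (Suc i) (Suc m). v ^ rmax_above c w) =
        (\<Sum>w\<in>(\<Union>j\<le>m. sorted_words (>) i j). (if c \<le> m then v else 1) * v ^ rmax_above c w)"
    proof (rule sum.reindex_bij_witness[where i = "\<lambda>w. Suc m # w" and j = tl])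
      fix w assume w: "w \<in> sorted_words (>) (Suc i) (Suc m)"
      then obtain u a where u: "w = a # u" by (cases w) (auto simp: sorted_words_def words_def)
      have "max_letter u < a" using w
        by (auto simp: u sorted_words_def words_def max_letter_less_iff)
      moreover from this have "a = Suc m" using w by (auto simp: u sorted_words_def words_def)
      note u = u[unfolded this] and this
      ultimately show "Suc m # tl w = w" 
        "(if c \<le> m then v else 1) * v ^ rmax_above c (tl w) = v ^ rmax_above c w"
        "tl w \<in> (\<Union>j\<le>m. sorted_words (>) i j)"
        using w by (auto simp: sorted_words_def words_def)
    next
      fix w assume w: "w \<in> (\<Union>j\<le>m. sorted_words (>) i j)"
      show "tl (Suc m # w) = w" by simp
      from w have "max_letter w < Suc m" by (auto simp: sorted_words_def words_def)
      thus "Suc m # w \<in> sorted_words (>) (Suc i) (Suc m)" using w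
        by (auto simp: sorted_words_def words_def max_letter_less_iff)
    qed
    thus ?thesis
      unfolding Suc const_X_const_mult_nth
      by (simp add: block_gf_def sum_UN_sorted_words fps_sum_nth mult_ac flip: sum_distrib_left)
  qed
qed

lemma one_minus_X_mult_inverse: "(1 - fps_X) * inverse (1 - fps_X :: 'a::field fps) = 1"
  by (rule inverse_mult_eq_1') simp

text \<open>With threshold \<open>m\<close> no letter is weighted. Writing H m for the sum, removal
  of a largest letter gives H (m + 1) = H m + t H (m + 1), so each letter of the alphabet
  contributes 1/(1 - t).\<close>

lemma sum_block_gf_le:
  "(\<Sum>j\<le>m. block_gf (\<le>) 1 v m j) = inverse (1 - fps_X :: 'a::field fps) ^ m"
proof (induction m)
  case (Suc m)
  let ?H = "\<lambda>m. \<Sum>j\<le>m. block_gf (\<le>) 1 v m j"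
  define h where "h = ?H (Suc m)"
  have "h = (\<Sum>j\<le>m. block_gf (\<le>) 1 v (Suc m) j) + fps_X * h"
    unfolding h_def by (subst sum.atMost_Suc) (simp add: block_gf_le_Suc del: sum.atMost_Suc)
  also have "(\<Sum>j\<le>m. block_gf (\<le>) 1 v (Suc m) j) = ?H m"
    by (intro sum.cong refl block_gf_cong_above) auto
  also have "\<dots> = inverse (1 - fps_X) ^ m" by (rule Suc)
  finally have "(1 - fps_X) * h = inverse (1 - fps_X) ^ m" by (simp add: left_diff_distrib diff_eq_eq)
  hence "(1 - fps_X) * inverse (1 - fps_X) * h = inverse (1 - fps_X) ^ Suc m"
    by (metis mult.assoc mult.left_commute power_Suc)
  thus ?case by (simp add: one_minus_X_mult_inverse h_def del: sum.atMost_Suc)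
qed (simp add: block_gf_0)

lemma transfer_le:
  fixes v :: "'a::field"
  defines "c \<equiv> inverse (1 - fps_X)"
  shows "transfer (\<le>) 1 v m m = c ^ m"
    and "m' \<le> m \<Longrightarrow> transfer (\<le>) 1 v m' (Suc m) = fps_const v * fps_X * c ^ Suc m"
  by (simp_all add: transfer_def block_gf_le_Suc sum_block_gf_le c_def mult_ac del: sum.atMost_Suc)

text \<open>A strictly decreasing word amounts to a set of letters, and all of them are
  right-to-left maxima. A letter up to \<open>c\<close> contributes 1 + st, a letter above
  \<open>c\<close> contributes 1 + svt.\<close>

lemma sum_block_gf_gt:
  "(\<Sum>j\<le>m. block_gf (>) s v c j) =
    (1 + fps_const s * fps_X) ^ min c m * (1 + fps_const (s * v) * fps_X) ^ (m - c)"
proof (induction m)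
  case (Suc m)
  thus ?case
    by (cases "c \<le> m") (auto simp: block_gf_gt_Suc algebra_simps min_def Suc_diff_le not_less_eq_eq
       simp flip: fps_const_mult)
qed (simp add: block_gf_0)

lemma transfer_gt:
  shows "transfer (>) s v m m = (1 + fps_const s * fps_X) ^ m"
    and "m' \<le> m \<Longrightarrow> transfer (>) s v m' (Suc m) =
      fps_const (s * v) * fps_X * (1 + fps_const s * fps_X) ^ m' * (1 + fps_const (s * v) * fps_X) ^ (m - m')"
  by (simp_all add: transfer_def block_gf_gt_Suc sum_block_gf_gt min_def mult_ac
      flip: fps_const_mult)

section \<open>Solving the transfer recurrence\<close>

text \<open>
  With \<open>Z k = \<Sum>m. V k m * X ^ m\<close>, the assumptions amount to
  \<open>Z (Suc k) * (1 - a X) = Z k (c X) * (1 - b X)\<close>. Hence substituting \<open>c X\<close> for \<open>X\<close> in the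
  claim for \<open>k\<close> yields the claim for \<open>Suc k\<close>.
\<close>

lemma transfer_series:
  fixes a b c :: "'b::idom" and V :: "nat \<Rightarrow> nat \<Rightarrow> 'b"
  assumes V0: "\<And>m. V 0 m = (if m = 0 then 1 else 0)"
    and V_Suc: "\<And>k m. V (Suc k) m = (\<Sum>m'\<le>m. K m' m * V k m')"
    and K1: "\<And>m. K m m = c ^ m"
    and K2: "\<And>m. K m (Suc m) = (a - b) * c ^ m"
    and K3: "\<And>m' m. m' < m \<Longrightarrow> K m' (Suc m) = a * K m' m"
  shows "Abs_fps (V (Suc k)) * (1 - fps_const (a * c ^ k) * fps_X) =
    Abs_fps (V k) * (1 - fps_const (b * c ^ k) * fps_X)"
proof -
  let ?X = "fps_const c * fps_X"
  \<comment> \<open>Passing from column m to m + 1 of \<open>K\<close> multiplies all entries with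
    m' < m by \<open>a\<close>. Subtracting a times the previous coefficient therefore leaves only
    terms with V k m and V k (m + 1).\<close>
  have rec: "V (Suc k) (Suc m) - a * V (Suc k) m = c ^ Suc m * V k (Suc m) - b * c ^ m * V k m" for k m
  proof -
    have "V (Suc k) (Suc m) = (\<Sum>m'<m. K m' (Suc m) * V k m') + K m (Suc m) * V k m +
        K (Suc m) (Suc m) * V k (Suc m)"
      by (simp add: V_Suc flip: lessThan_Suc_atMost)
    also have "(\<Sum>m'<m. K m' (Suc m) * V k m') = a * (\<Sum>m'<m. K m' m * V k m')"
      by (simp add: K3 sum_distrib_left mult.assoc)
    also have "(\<Sum>m'<m. K m' m * V k m') = V (Suc k) m - K m m * V k m"
      by (simp add: V_Suc flip: lessThan_Suc_atMost)
    finally show ?thesis by (simp add: K1 K2 algebra_simps)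
  qed
  have step: "Abs_fps (V (Suc k)) * (1 - fps_const a * fps_X) =
    (Abs_fps (V k) oo ?X) * (1 - fps_const b * fps_X)" for k
  proof (rule fps_ext)
    fix m show "(Abs_fps (V (Suc k)) * (1 - fps_const a * fps_X)) $ m =
      ((Abs_fps (V k) oo ?X) * (1 - fps_const b * fps_X)) $ m"
    proof (cases m)
      case 0
      thus ?thesis by (simp add: fps_compose_linear V_Suc K1)
    next
      case (Suc i)
      thus ?thesis using rec[of k i]
        unfolding fps_compose_linear by (simp add: algebra_simps)
    qed
  qed
  have lin: "(1 - fps_const (d * c ^ k) * fps_X) oo ?X = 1 - fps_const (d * c ^ Suc k) * fps_X" for d k
    by (auto simp: fps_compose_linear fps_eq_iff le_Suc_eq)
  show ?thesis
  proof (induction k)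
    case 0
    have "Abs_fps (V 0) = 1" by (simp add: V0 fps_eq_iff)
    thus ?case using step[of 0] by simp
  next
    case (Suc k)
    let ?g = "1 - fps_const a * fps_X"
    let ?h = "1 - fps_const b * fps_X"
    \<comment> \<open>The factor 1 - aX makes \<open>step\<close> applicable on both sides; having
      constant term 1, it is cancelled at the end.\<close>
    have "?g * (Abs_fps (V (Suc (Suc k))) * (1 - fps_const (a * c ^ Suc k) * fps_X)) =
       (Abs_fps (V (Suc (Suc k))) * ?g) * (1 - fps_const (a * c ^ Suc k) * fps_X)"
      by (simp only: mult_ac)
    also have "\<dots> = (Abs_fps (V (Suc k)) oo ?X) * (1 - fps_const (a * c ^ Suc k) * fps_X) * ?h"
      unfolding step by (simp only: mult_ac)
    also have "(Abs_fps (V (Suc k)) oo ?X) * (1 - fps_const (a * c ^ Suc k) * fps_X) =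
       (Abs_fps (V (Suc k)) * (1 - fps_const (a * c ^ k) * fps_X)) oo ?X"
      by (simp add: fps_compose_mult_distrib lin del: power_Suc)
    also have "\<dots> = (Abs_fps (V k) oo ?X) * (1 - fps_const (b * c ^ Suc k) * fps_X)"
      unfolding Suc by (simp add: fps_compose_mult_distrib lin del: power_Suc)
    also have "\<dots> * ?h = ((Abs_fps (V k) oo ?X) * ?h) * (1 - fps_const (b * c ^ Suc k) * fps_X)"
      by (simp only: mult_ac)
    also have "\<dots> = ?g * (Abs_fps (V (Suc k)) * (1 - fps_const (b * c ^ Suc k) * fps_X))"
      unfolding step[symmetric] by (simp only: mult_ac)
    finally have "?g * (Abs_fps (V (Suc (Suc k))) * (1 - fps_const (a * c ^ Suc k) * fps_X)) =
      ?g * (Abs_fps (V (Suc k)) * (1 - fps_const (b * c ^ Suc k) * fps_X))" .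
    moreover have "?g $ 0 \<noteq> 0" by simp
    hence "?g \<noteq> 0" by force
    ultimately show ?case by (simp only: mult_cancel_left) simp
  qed
qed

text \<open>The transfer recurrence with a = c = 1/(1 - t) and b = (1 - vt) c. The outer variable
  stands for x; the coefficients are series in t.\<close>

lemma word_series_le:
  fixes v :: "'a::field"
  defines "c \<equiv> inverse (1 - fps_X)"
  shows "Abs_fps (word_gf (\<le>) 1 v (Suc k)) * (1 - fps_const (c ^ Suc k) * fps_X) =
    Abs_fps (word_gf (\<le>) 1 v k) * (1 - fps_const ((1 - fps_const v * fps_X) * c ^ Suc k) * fps_X)"
proof -
  have "Abs_fps (word_gf (\<le>) 1 v (Suc k)) * (1 - fps_const (c * c ^ k) * fps_X) =
    Abs_fps (word_gf (\<le>) 1 v k) * (1 - fps_const (((1 - fps_const v * fps_X) * c) * c ^ k) * fps_X)"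
  proof (rule transfer_series[where K = "transfer (\<le>) 1 v"])
    show "transfer (\<le>) 1 v m (Suc m) = (c - (1 - fps_const v * fps_X) * c) * c ^ m" for m
      by (simp add: transfer_le flip: c_def) (simp add: algebra_simps)
    show "transfer (\<le>) 1 v m' (Suc m) = c * transfer (\<le>) 1 v m' m" if "m' < m" for m' m
      using that by (cases m) (simp_all add: transfer_le flip: c_def)
  qed (simp_all add: word_gf_0 word_gf_Suc transp_def transfer_le c_def)
  thus ?thesis by (simp add: mult_ac)
qed

text \<open>With s = -1 the factors 1 + st and 1 + svt of a block become c = 1 - t and a = 1 - vt,
  and b = 1.\<close>

lemma word_series_gt:
  fixes v :: "'a::field"
  defines "c \<equiv> 1 - fps_X"
  shows "Abs_fps (word_gf (>) (-1) v (Suc k)) * (1 - fps_const ((1 - fps_const v * fps_X) * c ^ k) * fps_X) =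
    Abs_fps (word_gf (>) (-1) v k) * (1 - fps_const (c ^ k) * fps_X)"
proof -
  have c: "c = 1 + fps_const (-1) * fps_X" by (simp add: c_def flip: fps_const_neg)
  have a: "1 - fps_const v * fps_X = 1 + fps_const (-1 * v) * fps_X" by (simp flip: fps_const_neg)
  have "Abs_fps (word_gf (>) (-1) v (Suc k)) * (1 - fps_const ((1 - fps_const v * fps_X) * c ^ k) * fps_X) =
    Abs_fps (word_gf (>) (-1) v k) * (1 - fps_const (1 * c ^ k) * fps_X)"
  proof (rule transfer_series[where K = "transfer (>) (-1) v"])
    show "transfer (>) (-1) v m (Suc m) = (1 - fps_const v * fps_X - 1) * c ^ m" for m
      unfolding a c by (simp only: transfer_gt order.refl) simp
    show "transfer (>) (-1) v m' (Suc m) = (1 - fps_const v * fps_X) * transfer (>) (-1) v m' m"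
      if "m' < m" for m' m
      using that unfolding a c by (cases m) (simp_all only: transfer_gt, simp add: Suc_diff_le mult_ac)
    show "transfer (>) (-1) v m m = c ^ m" for m
      unfolding c by (rule transfer_gt)
  qed (simp_all add: word_gf_0 word_gf_Suc transp_def)
  thus ?thesis by simp
qed

section \<open>Standardization\<close>

text \<open>
  For \<open>q = inv p\<close> these labellings are the words \<open>g \<circ> p\<close> over \<open>{1..l}\<close> whose standardization is \<open>p\<close>.
\<close>

definition labels :: "nat \<Rightarrow> (nat \<Rightarrow> nat) \<Rightarrow> nat \<Rightarrow> (nat \<Rightarrow> nat) set" where
  "labels n q l = {g \<in> extensional {1..n}. (\<forall>i\<in>{1..n}. 1 \<le> g i) \<and> (0 < n \<longrightarrow> g n \<le> l) \<and>
     (\<forall>i\<in>{1..<n}. if q i > q (Suc i) then g i < g (Suc i) else g i \<le> g (Suc i))}"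

lemma labels_step:
  assumes "g \<in> labels n q l" "i \<in> {1..<n}"
  shows "q i > q (Suc i) \<Longrightarrow> g i < g (Suc i)" "g i \<le> g (Suc i)"
proof -
  have "if q i > q (Suc i) then g i < g (Suc i) else g i \<le> g (Suc i)"
    using assms unfolding labels_def by blast
  thus "q i > q (Suc i) \<Longrightarrow> g i < g (Suc i)" "g i \<le> g (Suc i)" by (auto split: if_splits)
qed

lemma labels_mono:
  assumes "g \<in> labels n q l" "1 \<le> i" "i \<le> j" "j \<le> n"
  shows "g i \<le> g j"
  using assms(3,4)
proof (induction j rule: dec_induct)
  case (step j)
  hence "j \<in> {1..<n}" using assms(2) by auto
  hence "g j \<le> g (Suc j)" by (rule labels_step(2)[OF assms(1)])
  thus ?case using step by simp
qed simp

lemma labels_bounds: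
  assumes "g \<in> labels n q l" "i \<in> {1..n}"
  shows "1 \<le> g i" "g i \<le> l"
  using labels_mono[OF assms(1), of i n] assms unfolding labels_def by auto

lemma finite_labels [simp]: "finite (labels n q l)"
proof (rule finite_subset)
  show "labels n q l \<subseteq> {1..n} \<rightarrow>\<^sub>E {1..l}"
  proof
    fix g assume g: "g \<in> labels n q l"
    hence "g \<in> extensional {1..n}" by (simp add: labels_def)
    thus "g \<in> {1..n} \<rightarrow>\<^sub>E {1..l}" using labels_bounds[OF g] by (auto simp: PiE_def)
  qed
qed (simp add: finite_PiE)

lemma labels_0: "labels 0 q l = {\<lambda>_. undefined}"
  by (auto simp: labels_def)

lemma card_labels_Suc_0: "card (labels (Suc n) q 0) = 0"
  using labels_bounds[of _ "Suc n" q 0 "Suc n"] by fastforce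

text \<open>Either the last label is at most \<open>l\<close>, or it is \<open>Suc l\<close> and
  gets removed; what remains ends at most in \<open>l\<close> if a strict increase is required at
  \<open>n\<close>, and at most in \<open>Suc l\<close> otherwise. The bound \<open>l\<close> for n
  = 0 lets the first label contribute X to the series below.\<close>

lemma card_labels_Suc:
  "card (labels (Suc n) q (Suc l)) = card (labels (Suc n) q l) +
     card (labels n q (if n = 0 \<or> q n > q (Suc n) then l else Suc l))"
proof -
  let ?L = "labels n q (if n = 0 \<or> q n > q (Suc n) then l else Suc l)"
  let ?f = "\<lambda>g. g(Suc n := Suc l)"
  have "labels (Suc n) q (Suc l) = labels (Suc n) q l \<union> ?f ` ?L"
  proof (intro set_eqI iffI)
    fix g assume g: "g \<in> labels (Suc n) q (Suc l)"
    show "g \<in> labels (Suc n) q l \<union> ?f ` ?L"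
    proof (cases "g (Suc n) \<le> l")
      case True thus ?thesis using g by (auto simp: labels_def)
    next
      case False
      hence gl: "g (Suc n) = Suc l" using g by (auto simp: labels_def)
      have "restrict g {1..n} \<in> ?L"
        using g gl by (auto simp: labels_def split: if_splits)
          (metis Suc_leI atLeastLessThan_iff less_Suc_eq less_Suc_eq_le not_less_eq_eq)+
      moreover have "g = ?f (restrict g {1..n})"
        using g gl by (auto simp: labels_def fun_eq_iff extensional_def)
      ultimately show ?thesis by blast
    qed
  next
    fix g assume "g \<in> labels (Suc n) q l \<union> ?f ` ?L"
    thus "g \<in> labels (Suc n) q (Suc l)"
    proof
      assume "g \<in> ?f ` ?L"
      then obtain h where h: "h \<in> ?L" "g = ?f h" by auto
      show ?thesis using h
        by (auto simp: labels_def extensional_def less_Suc_eq split: if_splits)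
    qed (auto simp: labels_def)
  qed
  moreover have "labels (Suc n) q l \<inter> ?f ` ?L = {}"
    by (auto simp: labels_def)
  moreover have "inj_on ?f ?L"
  proof (rule inj_onI)
    fix g h assume gh: "g \<in> ?L" "h \<in> ?L" "?f g = ?f h"
    have "g i = h i" for i
    proof (cases "i = Suc n")
      case True thus ?thesis using gh(1,2) by (auto simp: labels_def extensional_def)
    next
      case False thus ?thesis using gh(3) by (metis fun_upd_other)
    qed
    thus "g = h" by blast
  qed
  hence "card (?f ` ?L) = card ?L" by (rule card_image)
  ultimately show ?thesis by (simp add: card_Un_disjoint)
qed

lemma des_0: "des 0 q = 0"
  unfolding des_def card_eq_0_iff by auto

lemma des_Suc:
  "des (Suc n) q = des n q + (if 0 < n \<and> q n > q (Suc n) then 1 else 0)"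
proof (cases n)
  case (Suc m)
  have "{i \<in> {1..Suc n - 1}. q i > q (i + 1)} = {i \<in> {1..n - 1}. q i > q (i + 1)} \<union>
      (if q n > q (Suc n) then {n} else {})"
    using Suc by (auto simp: le_Suc_eq)
  thus ?thesis using Suc unfolding des_def by simp
qed (simp add: des_def)

text \<open>Differences in \<open>l\<close> prescribe the last label. Each label thus costs one
  factor 1 - X, and it yields X if it is the first or a descent of \<open>q\<close> precedes
  it.\<close>

lemma labels_series:
  "(1 - fps_X) ^ Suc n * Abs_fps (\<lambda>l. of_nat (card (labels n q l))) =
    (if n = 0 then 1 else fps_X ^ Suc (des n q) :: 'a::comm_ring_1 fps)"
proof (induction n)
  case 0
  show ?case by (simp add: fps_eq_iff fps_one_minus_X_mult_nth labels_0)
next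
  case (Suc n)
  let ?G = "\<lambda>n. Abs_fps (\<lambda>l. of_nat (card (labels n q l))) :: 'a fps"
  have step: "(1 - fps_X) * ?G (Suc n) = (if n = 0 \<or> q n > q (Suc n) then fps_X else 1) * ?G n"
  proof (rule fps_ext)
    fix l show "((1 - fps_X) * ?G (Suc n)) $ l =
        ((if n = 0 \<or> q n > q (Suc n) then fps_X else 1) * ?G n) $ l"
      by (cases l; cases n)
        (auto simp: fps_one_minus_X_mult_nth card_labels_Suc_0 card_labels_Suc labels_0)
  qed
  have "(1 - fps_X) ^ Suc (Suc n) * ?G (Suc n) = (1 - fps_X) ^ Suc n * ((1 - fps_X) * ?G (Suc n))"
    by (simp only: power_Suc2 mult.assoc)
  also have "\<dots> = (if n = 0 \<or> q n > q (Suc n) then fps_X else 1) * ((1 - fps_X) ^ Suc n * ?G n)"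
    unfolding step by (rule mult.left_commute)
  also have "\<dots> = fps_X ^ Suc (des (Suc n) q)"
    unfolding Suc.IH des_Suc by (simp add: des_0)
  finally show ?case by simp
qed

text \<open>For neighbours, a descent of \<open>q\<close> forces the label to grow, and elsewhere
  equal labels come with increasing \<open>q\<close>. The general case follows by transitivity of
  the lexicographic order.\<close>

lemma labels_lex:
  assumes g: "g \<in> labels n q l" and "1 \<le> a" "a < b" "b \<le> n" and inj: "inj_on q {1..n}"
  shows "g a < g b \<or> g a = g b \<and> q a < q b"
proof -
  have adj: "g i < g (Suc i) \<or> g i = g (Suc i) \<and> q i < q (Suc i)" if "i \<in> {1..<n}" for i
  proof -
    have "q i \<noteq> q (Suc i)" using inj_on_eq_iff[OF inj, of i "Suc i"] that by simp
    thus ?thesis using labels_step[OF g that]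
      by (cases "q (Suc i) < q i") (auto simp: not_less le_less)
  qed
  have "Suc a \<le> b" using assms(3) by simp
  thus ?thesis using assms(4)
  proof (induction b rule: dec_induct)
    case base
    thus ?case using adj[of a] assms(2) by auto
  next
    case (step b)
    thus ?case using adj[of b] assms(2) by auto
  qed
qed

text \<open>\<open>inv p\<close> turns values back into positions, so the lexicographic order of
  labels and \<open>inv p\<close> becomes that of letters and positions. In other words,
  \<open>p\<close> standardizes \<open>g \<circ> p\<close>, with equal letters ranked from left to
  right.\<close>

lemma labels_less_iff:
  assumes p: "p permutes {1..n}" and g: "g \<in> labels n (inv p) l"
    and i: "i \<in> {1..n}" and j: "j \<in> {1..n}"
  shows "p i < p j \<longleftrightarrow> g (p i) < g (p j) \<or> g (p i) = g (p j) \<and> i < j"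
proof -
  have inj: "inj_on (inv p) {1..n}" by (rule permutes_inj_on[OF permutes_inv[OF p]])
  have inv: "inv p (p i) = i" for i by (rule permutes_inverses(2)[OF p])
  have b: "p i \<in> {1..n}" "p j \<in> {1..n}" using i j by (simp_all only: permutes_in_image[OF p])
  have less: "g (p a) < g (p b) \<or> g (p a) = g (p b) \<and> a < b"
    if "p a < p b" "p a \<in> {1..n}" "p b \<in> {1..n}" for a b
    using labels_lex[OF g _ _ _ inj, of "p a" "p b"] that by (simp add: inv)
  consider "p i < p j" | "p i = p j" | "p j < p i" by linarith
  thus ?thesis
  proof cases
    case 1 thus ?thesis using less[OF 1 b] by simp
  next
    case 2
    hence "i = j" using inv by metis
    thus ?thesis by simp
  next
    case 3 thus ?thesis using less[OF 3 b(2,1)] by auto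
  qed
qed

section \<open>Statistics read off the one-line word\<close>

lemma blocks_map_cong:
  assumes "sorted_wrt (\<lambda>i j. R (f i) (f j) \<longleftrightarrow> R (g i) (g j)) xs"
  shows "blocks R k (map f xs) = blocks R k (map g xs)"
  using assms
proof (induction xs arbitrary: k)
  case (Cons a xs)
  have hd: "R (f a) (hd (map f xs)) \<longleftrightarrow> R (g a) (hd (map g xs))" if "xs \<noteq> []"
    using that Cons.prems by (cases xs) auto
  show ?case
  proof (induction k)
    case (Suc k)
    have "blocks R k (map f xs) = blocks R k (map g xs)" for k using Cons by simp
    thus ?case using Suc hd by (cases "xs = []") simp_all
  qed simp
qed simp

lemma rmax_above_map_cong:
  assumes "sorted_wrt (\<lambda>i j. f j < f i \<longleftrightarrow> g j < g i) xs" "\<forall>i\<in>set xs. 0 < f i \<and> 0 < g i"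
  shows "rmax_above 0 (map f xs) = rmax_above 0 (map g xs)"
  using assms by (induction xs) (auto simp: max_letter_less_iff)

lemma rmax_above_map:
  assumes "1 \<le> a" "\<forall>i\<in>{1..n}. 0 < p i"
  shows "rmax_above 0 (map p [a..<Suc n]) =
    card {i \<in> {a..n}. \<forall>j\<in>{1..n}. j > i \<longrightarrow> p i > p j}"
proof (cases "a \<le> Suc n")
  case True
  thus ?thesis using assms(1)
  proof (induction a rule: inc_induct)
    case (step a)
    have a: "a \<le> n" "[a..<Suc n] = a # [Suc a..<Suc n]" using step by (auto simp: upt_conv_Cons)
    have "{i \<in> {a..n}. \<forall>j\<in>{1..n}. j > i \<longrightarrow> p i > p j} =
        (if \<forall>j\<in>{1..n}. j > a \<longrightarrow> p a > p j then {a} else {}) \<union>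
        {i \<in> {Suc a..n}. \<forall>j\<in>{1..n}. j > i \<longrightarrow> p i > p j}"
      using a(1) by (auto simp: Suc_le_eq order_le_less)
    moreover have "max_letter (map p [Suc a..<Suc n]) < p a \<and> 0 < p a \<longleftrightarrow> (\<forall>j\<in>{1..n}. j > a \<longrightarrow> p a > p j)"
    proof -
      have "set [Suc a..<Suc n] = {j \<in> {1..n}. j > a}" by auto
      thus ?thesis using a(1) step.prems assms(2) by (auto simp: max_letter_less_iff simp del: upt_Suc set_upt)
    qed
    ultimately show ?case
      using step by (auto simp: a(2) simp del: upt_Suc)
  qed simp
qed simp

lemma breaks_map:
  "breaks R (map p [a..<Suc n]) = card {i \<in> {a..<n}. \<not> R (p i) (p (Suc i))}"
proof (cases "a \<le> n")
  case True
  thus ?thesis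
  proof (induction a rule: inc_induct)
    case (step a)
    have a: "a < n" "[a..<Suc n] = a # Suc a # [Suc (Suc a)..<Suc n]" "[Suc a..<Suc n] = Suc a # [Suc (Suc a)..<Suc n]"
      using step by (auto simp: upt_conv_Cons)
    have "{i \<in> {a..<n}. \<not> R (p i) (p (Suc i))} =
        (if R (p a) (p (Suc a)) then {} else {a}) \<union> {i \<in> {Suc a..<n}. \<not> R (p i) (p (Suc i))}"
      using a(1) by (auto simp: Suc_le_eq order_le_less)
    thus ?case using step.IH unfolding a(2,3) by simp
  qed simp
qed simp

lemma rmax_conv_word:
  assumes "p permutes {1..n}"
  shows "rmax n p = rmax_above 0 (map p [1..<Suc n])"
  using rmax_above_map[of 1 n p] permutes_bounds(1)[OF assms] rmax_positions[OF assms]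
  by (simp add: Suc_le_eq)

lemma breaks_le_conv_des: "breaks (\<le>) (map p [1..<Suc n]) = des n p"
proof -
  have "{i \<in> {1..<n}. \<not> p i \<le> p (Suc i)} = {i \<in> {1..n - 1}. p i > p (i + 1)}" by auto
  thus ?thesis unfolding breaks_map des_def by simp
qed

text \<open>Breaks for \<open>(>)\<close> are the non-descents among the n - 1 neighbouring pairs.
  This exchange underlies the expansion in the inverse of u.\<close>

lemma breaks_gt_conv_des: "breaks (>) (map p [1..<Suc n]) + des n p = n - 1"
proof -
  have "{1..n - 1} = {i \<in> {1..<n}. \<not> p i > p (Suc i)} \<union> {i \<in> {1..n - 1}. p i > p (i + 1)}" by auto
  hence "card {1..n - 1} = card ({i \<in> {1..<n}. \<not> p i > p (Suc i)} \<union> {i \<in> {1..n - 1}. p i > p (i + 1)})"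
    by (rule arg_cong)
  also have "\<dots> = card {i \<in> {1..<n}. \<not> p i > p (Suc i)} + card {i \<in> {1..n - 1}. p i > p (i + 1)}"
    by (rule card_Un_disjoint) auto
  finally have "card {1..n - 1} = card {i \<in> {1..<n}. \<not> p i > p (Suc i)} + card {i \<in> {1..n - 1}. p i > p (i + 1)}" .
  thus ?thesis unfolding breaks_map des_def by simp
qed

text \<open>Sending (p, g) to \<open>g \<circ> p\<close> is a bijection onto the words of length n
  over 1..l, with standardization as the way back. Since \<open>F\<close> does not change under
  standardization, the number of labellings counts the words that share the value at
  \<open>p\<close>.\<close>

lemma standardization:
  assumes F: "\<And>p g. p permutes {1..n} \<Longrightarrow> g \<in> labels n (inv p) l \<Longrightarrow>
    F (map p [1..<Suc n]) = (F (map (g \<circ> p) [1..<Suc n]) :: 'a::comm_ring_1)"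
  shows "(\<Sum>p | p permutes {1..n}. F (map p [1..<Suc n]) * of_nat (card (labels n (inv p) l))) =
    (\<Sum>w\<in>(\<Union>m\<le>l. words n m). F w)"
proof -
  let ?P = "{p. p permutes {1..n}}"
  define W where "W = (\<Union>m\<le>l. words n m)"
  have W: "w \<in> W \<longleftrightarrow> length w = n \<and> set w \<subseteq> {1..l}" for w
  proof -
    have "w \<in> W \<longleftrightarrow> length w = n \<and> 0 \<notin> set w \<and> (\<forall>a\<in>set w. a \<le> l)"
      by (auto simp: W_def words_def simp flip: max_letter_le_iff)
    moreover have "set w \<subseteq> {1..l} \<longleftrightarrow> 0 \<notin> set w \<and> (\<forall>a\<in>set w. a \<le> l)"
      unfolding subset_iff atLeastAtMost_iff Ball_def One_nat_def Suc_le_eq by (metis gr_zeroI less_irrefl)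
    ultimately show ?thesis by blast
  qed
  let ?h = "\<lambda>(p, g). map (g \<circ> p) [1..<Suc n]"
  have nth_h: "map (g \<circ> p) [1..<Suc n] ! (i - 1) = g (p i)" if "i \<in> {1..n}" for g p :: "nat \<Rightarrow> nat" and i
    using that by (subst nth_map_upt) auto
  have bij: "bij_betw ?h (SIGMA p:?P. labels n (inv p) l) W"
  proof (rule bij_betw_imageI)
    show "inj_on ?h (SIGMA p:?P. labels n (inv p) l)"
    proof (rule inj_onI, clarify)
      fix p g p' g'
      assume p: "p permutes {1..n}" "g \<in> labels n (inv p) l"
        and p': "p' permutes {1..n}" "g' \<in> labels n (inv p') l"
        and eq: "map (g \<circ> p) [1..<Suc n] = map (g' \<circ> p') [1..<Suc n]"
      have gp: "g (p i) = g' (p' i)" if "i \<in> {1..n}" for i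
        using nth_h[OF that, of g p] nth_h[OF that, of g' p'] by (simp only: eq)
      \<comment> \<open>A permutation is determined by its order relations, its value at i being the
        rank of i. By \<open>labels_less_iff\<close> the word determines these relations.\<close>
      have rank: "r i = card {j \<in> {1..n}. r j \<le> r i}" if "r permutes {1..n}" "i \<in> {1..n}" for r i
      proof -
        have "r ` {j \<in> {1..n}. r j \<le> r i} = {1..r i}"
        proof (intro set_eqI iffI)
          fix a assume a: "a \<in> {1..r i}"
          hence "inv r a \<in> {1..n}"
            using permutes_bounds(2)[OF that] by (subst permutes_in_image[OF permutes_inv[OF that(1)]]) auto
          thus "a \<in> r ` {j \<in> {1..n}. r j \<le> r i}"
            using a permutes_inverses(1)[OF that(1), of a] by (metis (no_types, lifting) CollectI atLeastAtMost_iff imageI)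
        qed (use permutes_bounds(1)[OF that(1)] in auto)
        moreover have "card (r ` {j \<in> {1..n}. r j \<le> r i}) = card {j \<in> {1..n}. r j \<le> r i}"
          by (rule card_image) (rule permutes_inj_on[OF that(1)])
        ultimately show ?thesis by simp
      qed
      have "p i = p' i" for i
      proof (cases "i \<in> {1..n}")
        case True
        have "p j \<le> p i \<longleftrightarrow> p' j \<le> p' i" if j: "j \<in> {1..n}" for j
          using labels_less_iff[OF p True j] labels_less_iff[OF p' True j]
          unfolding gp[OF True] gp[OF j] by linarith
        hence "{j \<in> {1..n}. p j \<le> p i} = {j \<in> {1..n}. p' j \<le> p' i}" by blast
        thus ?thesis using rank[OF p(1) True] rank[OF p'(1) True] by simp
      next
        case False thus ?thesis using permutes_not_in[OF p(1)] permutes_not_in[OF p'(1)] by metis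
      qed
      hence pp: "p = p'" by blast
      have "g a = g' a" for a
      proof (cases "a \<in> {1..n}")
        case True
        hence "inv p a \<in> {1..n}" by (subst permutes_in_image[OF permutes_inv[OF p(1)]])
        thus ?thesis using gp[of "inv p a"] pp permutes_inverses(1)[OF p(1), of a] by simp
      next
        case False thus ?thesis using p(2) p'(2) by (auto simp: labels_def extensional_def)
      qed
      thus "p = p' \<and> g = g'" using pp by blast
    qed
  next
    show "?h ` (SIGMA p:?P. labels n (inv p) l) = W"
    proof (intro equalityI subsetI)
      fix w assume "w \<in> ?h ` (SIGMA p:?P. labels n (inv p) l)"
      then obtain p g where p: "p permutes {1..n}" "g \<in> labels n (inv p) l"
        and w: "w = map (g \<circ> p) [1..<Suc n]" by auto
      have "g (p i) \<in> {1..l}" if "i \<in> {1..n}" for i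
        using labels_bounds[OF p(2), of "p i"] permutes_in_image[OF p(1), of i] that by auto
      moreover have "set w = (\<lambda>i. g (p i)) ` {1..n}"
        by (simp add: w atLeastLessThanSuc_atLeastAtMost del: upt_Suc)
      moreover have "length w = n" by (simp add: w del: upt_Suc)
      ultimately show "w \<in> W" unfolding W by (simp only: image_subset_iff) simp
    next
      fix w assume w: "w \<in> W"
      \<comment> \<open>The shift translates positions 1..n into list indices.\<close>
      define x where "x = (\<lambda>i. w ! (i - 1))"
      define lt where "lt = (\<lambda>i j. x i < x j \<or> x i = x j \<and> i < (j::nat))"
      \<comment> \<open>The rank of position i in the order \<open>lt\<close>. As \<open>lt\<close>
        is irreflexive, i itself is counted, so ranks start at 1.\<close>
      define p where "p = (\<lambda>i. if i \<in> {1..n} then card {j \<in> {1..n}. \<not> lt i j} else i)"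
      have p_less: "p i < p j" if "i \<in> {1..n}" "j \<in> {1..n}" "lt i j" for i j
      proof -
        have "{k \<in> {1..n}. \<not> lt i k} \<subset> {k \<in> {1..n}. \<not> lt j k}"
          using that by (auto simp: lt_def psubset_eq set_eq_iff)
        thus ?thesis using that by (simp add: p_def psubset_card_mono)
      qed
      have lt_cases: "lt i j \<or> i = j \<or> lt j i" for i j by (auto simp: lt_def)
      have "p i \<in> {1..n}" if "i \<in> {1..n}" for i
      proof -
        have "i \<in> {j \<in> {1..n}. \<not> lt i j}" using that by (simp add: lt_def)
        hence "0 < card {j \<in> {1..n}. \<not> lt i j}" by (subst card_gt_0_iff) auto
        moreover have "card {j \<in> {1..n}. \<not> lt i j} \<le> card {1..n}" by (rule card_mono) auto
        ultimately show ?thesis using that by (simp add: p_def)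
      qed
      moreover have inj: "inj_on p {1..n}"
      proof (rule inj_onI)
        fix i j assume ij: "i \<in> {1..n}" "j \<in> {1..n}" "p i = p j"
        thus "i = j" using lt_cases[of i j] p_less[OF ij(1,2)] p_less[OF ij(2,1)] by auto
      qed
      ultimately have "bij_betw p {1..n} {1..n}"
        by (simp add: bij_betw_def endo_inj_surj image_subset_iff)
      hence p: "p permutes {1..n}" by (rule bij_imp_permutes) (auto simp: p_def)
      \<comment> \<open>The label of a value is the letter at the position where that value
        stands.\<close>
      define g where "g = restrict (\<lambda>a. x (inv p a)) {1..n}"
      have gp: "g (p i) = x i" if "i \<in> {1..n}" for i
        using that permutes_in_image[OF p, of i] by (simp add: g_def permutes_inverses(2)[OF p])
      have xl: "x i \<in> {1..l}" if "i \<in> {1..n}" for i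
        using w that unfolding W x_def by (meson One_nat_def atLeastAtMost_iff diff_less less_le_trans nth_mem subsetD zero_less_one Suc_le_eq diff_le_self order_less_le_trans)
      have inv_in: "inv p a \<in> {1..n}" if "a \<in> {1..n}" for a
        using that by (subst permutes_in_image[OF permutes_inv[OF p]])
      have "g \<in> labels n (inv p) l"
        unfolding labels_def
      proof (intro CollectI conjI ballI impI)
        show "g \<in> extensional {1..n}" by (simp add: g_def)
        show "1 \<le> g a" if "a \<in> {1..n}" for a using xl[OF inv_in[OF that]] that by (simp add: g_def)
        show "g n \<le> l" if "0 < n" using xl[OF inv_in, of n] that by (simp add: g_def)
        fix a assume a: "a \<in> {1..<n}"
        let ?i = "inv p a" and ?j = "inv p (Suc a)"
        have ij: "?i \<in> {1..n}" "?j \<in> {1..n}" using a inv_in[of a] inv_in[of "Suc a"] by simp_all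
        have pij: "p ?i = a" "p ?j = Suc a" by (rule permutes_inverses(1)[OF p])+
        \<comment> \<open>Consecutive values stand at positions consecutive in \<open>lt\<close>:
          the letters grow weakly, and strictly if the position drops.\<close>
        have "\<not> lt ?j ?i" using p_less[OF ij(2,1)] pij by auto
        moreover have "?i \<noteq> ?j" using pij by auto
        ultimately have "lt ?i ?j" using lt_cases by blast
        moreover have "g a = x ?i" "g (Suc a) = x ?j" using a by (auto simp: g_def)
        ultimately show "if ?i > ?j then g a < g (Suc a) else g a \<le> g (Suc a)" by (auto simp: lt_def)
      qed
      moreover have "?h (p, g) = w"
      proof (rule nth_equalityI)
        show "length (?h (p, g)) = length w" using w by (simp add: W)
        fix i assume "i < length (?h (p, g))"
        hence "Suc i \<in> {1..n}" by (simp del: upt_Suc)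
        from nth_h[OF this, of g p] gp[OF this] show "?h (p, g) ! i = w ! i"
          by (simp add: x_def del: upt_Suc)
      qed
      ultimately show "w \<in> ?h ` (SIGMA p:?P. labels n (inv p) l)" using p by blast
    qed
  qed
  have "(\<Sum>p\<in>?P. F (map p [1..<Suc n]) * of_nat (card (labels n (inv p) l))) =
    (\<Sum>p\<in>?P. \<Sum>g\<in>labels n (inv p) l. F (map (g \<circ> p) [1..<Suc n]))"
  proof (rule sum.cong[OF refl])
    fix p assume "p \<in> ?P"
    hence p: "p permutes {1..n}" by simp
    have "(\<Sum>g\<in>labels n (inv p) l. F (map (g \<circ> p) [1..<Suc n])) =
        (\<Sum>g\<in>labels n (inv p) l. F (map p [1..<Suc n]))"
      by (intro sum.cong refl F[OF p, symmetric])
    thus "F (map p [1..<Suc n]) * of_nat (card (labels n (inv p) l)) =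
        (\<Sum>g\<in>labels n (inv p) l. F (map (g \<circ> p) [1..<Suc n]))"
      by (simp add: mult.commute del: upt_Suc)
  qed
  also have "\<dots> = (\<Sum>pg\<in>(SIGMA p:?P. labels n (inv p) l). F (?h pg))"
    by (subst sum.Sigma) (simp_all add: finite_permutations case_prod_unfold)
  also have "\<dots> = (\<Sum>w\<in>W. F w)"
    by (rule sum.reindex_bij_betw[OF bij])
  finally show ?thesis unfolding W_def .
qed

text \<open>For positions i < j, both \<le> and > between letters survive standardization because
  ties are ranked from left to right. Hence right-to-left maxima and block counts agree for
  \<open>p\<close> and \<open>g \<circ> p\<close>.\<close>

lemma sum_permutations_conv_words:
  assumes R: "R = (\<le>) \<or> R = (>)"
  shows "(\<Sum>p | p permutes {1..n}. v ^ rmax n p * of_nat (blocks R k (map p [1..<Suc n])) *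
      of_nat (card (labels n (inv p) l))) =
    (\<Sum>m\<le>l. \<Sum>w\<in>words n m. v ^ rmax_above 0 w * (of_nat (blocks R k w) :: 'a::comm_ring_1))"
proof -
  let ?F = "\<lambda>w. v ^ rmax_above 0 w * (of_nat (blocks R k w) :: 'a)"
  have "(\<Sum>p | p permutes {1..n}. v ^ rmax n p * of_nat (blocks R k (map p [1..<Suc n])) *
      of_nat (card (labels n (inv p) l))) =
    (\<Sum>p | p permutes {1..n}. ?F (map p [1..<Suc n]) * of_nat (card (labels n (inv p) l)))"
    by (rule sum.cong) (simp_all add: rmax_conv_word del: upt_Suc One_nat_def)
  also have "\<dots> = (\<Sum>w\<in>(\<Union>m\<le>l. words n m). ?F w)"
  proof (rule standardization)
    fix p g assume p: "p permutes {1..n}" and g: "g \<in> labels n (inv p) l"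
    have pos: "\<forall>i\<in>set [1..<Suc n]. 0 < p i \<and> 0 < (g \<circ> p) i"
    proof
      fix i assume "i \<in> set [1..<Suc n]"
      hence i: "i \<in> {1..n}" by auto
      show "0 < p i \<and> 0 < (g \<circ> p) i"
        using permutes_bounds[OF p i] labels_bounds(1)[OF g, of "p i"] permutes_in_image[OF p, of i] i by simp
    qed
    have "sorted_wrt (\<lambda>i j. p j < p i \<longleftrightarrow> (g \<circ> p) j < (g \<circ> p) i) [1..<Suc n]"
      by (rule sorted_wrt_mono_rel[OF _ sorted_wrt_upt]) (auto simp: labels_less_iff[OF p g])
    from rmax_above_map_cong[OF this pos]
    have "rmax_above 0 (map p [1..<Suc n]) = rmax_above 0 (map (g \<circ> p) [1..<Suc n])" .
    moreover have "p j < p i \<longleftrightarrow> g (p j) < g (p i)" "p i \<le> p j \<longleftrightarrow> g (p i) \<le> g (p j)"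
      if "i \<in> set [1..<Suc n]" "j \<in> set [1..<Suc n]" "i < j" for i j
    proof -
      show "p j < p i \<longleftrightarrow> g (p j) < g (p i)" using labels_less_iff[OF p g, of j i] that by auto
      thus "p i \<le> p j \<longleftrightarrow> g (p i) \<le> g (p j)" by (simp flip: not_less)
    qed
    hence "sorted_wrt (\<lambda>i j. R (p i) (p j) \<longleftrightarrow> R ((g \<circ> p) i) ((g \<circ> p) j)) [1..<Suc n]"
      by (intro sorted_wrt_mono_rel[OF _ sorted_wrt_upt]) (use R in auto)
    hence "blocks R k (map p [1..<Suc n]) = blocks R k (map (g \<circ> p) [1..<Suc n])"
      by (rule blocks_map_cong)
    ultimately show "?F (map p [1..<Suc n]) = ?F (map (g \<circ> p) [1..<Suc n])" by simp
  qed
  also have "\<dots> = (\<Sum>m\<le>l. \<Sum>w\<in>words n m. ?F w)"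
    by (rule sum.UNION_disjoint) (simp, simp, auto simp: words_def)
  finally show ?thesis .
qed

section \<open>Power series\<close>

text \<open>
  The recurrence in \<open>k\<close> is proved with \<open>x\<close> as the outer variable, whereas \<open>ser\<close> has \<open>t\<close> outside \<open>x\<close>.
\<close>

definition swap_fps :: "'a::zero fps fps \<Rightarrow> 'a fps fps" where
  "swap_fps f = Abs_fps (\<lambda>n. Abs_fps (\<lambda>m. f $ m $ n))"

lemma swap_fps_nth [simp]: "swap_fps f $ n $ m = f $ m $ n"
  by (simp add: swap_fps_def)

lemma fps2_eqI: "(\<And>n m. f $ n $ m = g $ n $ m) \<Longrightarrow> f = (g :: 'a fps fps)"
  by (simp add: fps_eq_iff)

lemma swap_fps_mult: "swap_fps (f * g) = swap_fps f * swap_fps (g :: 'a::comm_ring_1 fps fps)"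
proof (rule fps2_eqI)
  fix n m
  show "swap_fps (f * g) $ n $ m = (swap_fps f * swap_fps g) $ n $ m"
    by (simp add: fps_mult_nth fps_sum_nth) (rule sum.swap)
qed

lemma swap_fps_minus: "swap_fps (f - g) = swap_fps f - swap_fps (g :: 'a::comm_ring_1 fps fps)"
  by (rule fps2_eqI) simp

lemma swap_fps_1: "swap_fps 1 = (1 :: 'a::comm_ring_1 fps fps)"
  by (rule fps2_eqI) simp

lemma swap_fps_power: "swap_fps (f ^ n) = swap_fps (f :: 'a::comm_ring_1 fps fps) ^ n"
  by (induction n) (simp_all add: swap_fps_1 swap_fps_mult)

lemma swap_fps_X: "swap_fps fps_X = fps_const (fps_X :: 'a::comm_ring_1 fps)"
  by (rule fps2_eqI) simp

lemma swap_fps_const_X: "swap_fps (fps_const (fps_X :: 'a::comm_ring_1 fps)) = fps_X"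
  by (rule fps2_eqI) simp

lemma swap_fps_const_const: "swap_fps (fps_const (fps_const a)) = fps_const (fps_const (a :: 'a::comm_ring_1))"
  by (rule fps2_eqI) simp

lemmas swap_fps_simps = swap_fps_mult swap_fps_minus swap_fps_1 swap_fps_power swap_fps_X
  swap_fps_const_X swap_fps_const_const

definition word_series :: "(nat \<Rightarrow> nat \<Rightarrow> bool) \<Rightarrow> 'a::comm_ring_1 \<Rightarrow> 'a \<Rightarrow> nat \<Rightarrow> 'a fps fps" where
  "word_series R s v k = swap_fps (Abs_fps (word_gf R s v k))"

text \<open>The quotient (Z (k + 1) - Z k)/x. Both series have constant coefficient 1 in x, so the
  index shift to \<open>Suc l\<close> carries out the division.\<close>

definition perm_series :: "(nat \<Rightarrow> nat \<Rightarrow> bool) \<Rightarrow> 'a::comm_ring_1 \<Rightarrow> 'a \<Rightarrow> nat \<Rightarrow> 'a fps fps" where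
  "perm_series R s v k =
     swap_fps (Abs_fps (\<lambda>l. word_gf R s v (Suc k) (Suc l) - word_gf R s v k (Suc l)))"

lemma word_gf_0_right: "word_gf R s v k 0 = 1"
  by (rule fps_ext) (simp add: word_gf_def words_0_right)

lemma word_series_0: "word_series R s v 0 = 1"
proof -
  have "Abs_fps (word_gf R s v 0) = 1" by (rule fps_ext) (simp add: word_gf_0)
  thus ?thesis by (simp add: word_series_def swap_fps_1)
qed

section \<open>Recurrences with t as the outer variable\<close>

lemma perm_series_mult:
  fixes A B :: "'a::field fps fps"
  assumes "Abs_fps (word_gf R s v (Suc k)) * (A - B * fps_X) = Abs_fps (word_gf R s v k) * (A - C * fps_X)"
  shows "perm_series R s v k * swap_fps (A - B * fps_X) = swap_fps (B - C) * word_series R s v k"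
proof -
  let ?Z = "\<lambda>k. Abs_fps (word_gf R s v k)"
  let ?h = "Abs_fps (\<lambda>l. word_gf R s v (Suc k) (Suc l) - word_gf R s v k (Suc l))"
  have h: "fps_X * ?h = ?Z (Suc k) - ?Z k"
  proof (rule fps_ext)
    fix n show "(fps_X * ?h) $ n = (?Z (Suc k) - ?Z k) $ n"
      by (cases n) (simp_all add: word_gf_0_right)
  qed
  \<comment> \<open>Subtracting Z k (A - BX) from both sides of the assumption leaves X (B - C) Z k
    on the right, and X cancels.\<close>
  have "fps_X * (?h * (A - B * fps_X)) = (?Z (Suc k) - ?Z k) * (A - B * fps_X)"
    unfolding h[symmetric] by (rule mult.assoc[symmetric])
  also have "\<dots> = fps_X * ((B - C) * ?Z k)"
    unfolding left_diff_distrib assms by (simp add: algebra_simps)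
  finally have "?h * (A - B * fps_X) = (B - C) * ?Z k" by simp
  hence "swap_fps (?h * (A - B * fps_X)) = swap_fps ((B - C) * ?Z k)" by simp
  thus ?thesis by (simp add: swap_fps_mult perm_series_def word_series_def)
qed

lemma one_minus_X_power_mult_inverse:
  "fps_const ((1 - fps_X) ^ n) * fps_const (inverse (1 - fps_X :: 'a::field fps) ^ n) = 1"
  by (simp add: one_minus_X_mult_inverse flip: power_mult_distrib)

text \<open>Multiplication by the power k + 1 of 1 - t clears the denominators in
  \<open>word_series_le\<close>; then the two variables are exchanged.\<close>

lemma series_le:
  fixes v :: "'a::field"
  defines "t \<equiv> fps_X :: 'a fps fps" and "x \<equiv> fps_const fps_X" and "w \<equiv> fps_const (fps_const v)"
  shows "word_series (\<le>) 1 v (Suc k) * (x - (1 - t) ^ Suc k) =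
      word_series (\<le>) 1 v k * (x - (1 - t) ^ Suc k - x * w * t)"
    and "perm_series (\<le>) 1 v k * ((1 - t) ^ Suc k - x) = w * t * word_series (\<le>) 1 v k"
proof -
  let ?Z = "\<lambda>k. Abs_fps (word_gf (\<le>) 1 v k)"
  let ?c = "fps_const (inverse (1 - fps_X) ^ Suc k) :: 'a fps fps"
  let ?d = "fps_const ((1 - fps_X) ^ Suc k) :: 'a fps fps"
  let ?b = "1 - fps_const (fps_const v * fps_X) :: 'a fps fps"
  have dc: "?d * ?c = 1" by (rule one_minus_X_power_mult_inverse)
  have "?Z (Suc k) * (1 - ?c * fps_X) = ?Z k * (1 - ?b * ?c * fps_X)"
    using word_series_le[of v k] by (simp flip: fps_const_1_eq_1)
  hence "?d * (?Z (Suc k) * (1 - ?c * fps_X)) = ?d * (?Z k * (1 - ?b * ?c * fps_X))" by simp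
  moreover have "?d * (?Z (Suc k) * (1 - ?c * fps_X)) = ?Z (Suc k) * (?d - (?d * ?c) * fps_X)"
    by (simp only: algebra_simps mult_1_left mult_1_right)
  moreover have "?d * (?Z k * (1 - ?b * ?c * fps_X)) = ?Z k * (?d - ?b * (?d * ?c) * fps_X)"
    by (simp only: algebra_simps mult_1_left mult_1_right)
  ultimately have eq: "?Z (Suc k) * (?d - 1 * fps_X) = ?Z k * (?d - ?b * fps_X)"
    unfolding dc by simp
  have d: "swap_fps ?d = (1 - t) ^ Suc k"
    unfolding t_def fps_const_power[symmetric] fps_const_sub[symmetric] fps_const_1_eq_1
    by (simp only: swap_fps_simps)
  have b: "swap_fps ?b = 1 - w * t"
    unfolding t_def w_def fps_const_mult[symmetric] by (simp only: swap_fps_simps)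
  have den: "swap_fps (?d - 1 * fps_X) = (1 - t) ^ Suc k - x"
    by (simp only: swap_fps_minus[of ?d] swap_fps_mult d swap_fps_1 mult_1_left swap_fps_X x_def)
  have num: "swap_fps (?d - ?b * fps_X) = (1 - t) ^ Suc k - (1 - w * t) * x"
    by (simp only: swap_fps_minus[of ?d] swap_fps_mult d b swap_fps_X x_def)
  have "swap_fps (?Z (Suc k) * (?d - 1 * fps_X)) = swap_fps (?Z k * (?d - ?b * fps_X))"
    by (simp only: eq)
  hence "word_series (\<le>) 1 v (Suc k) * ((1 - t) ^ Suc k - x) =
      word_series (\<le>) 1 v k * ((1 - t) ^ Suc k - (1 - w * t) * x)"
    unfolding swap_fps_mult[of "Abs_fps _"] den num word_series_def .
  \<comment> \<open>The sign is changed to reach the factors of the product in the first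
    formula.\<close>
  hence "- (word_series (\<le>) 1 v (Suc k) * ((1 - t) ^ Suc k - x)) =
      - (word_series (\<le>) 1 v k * ((1 - t) ^ Suc k - (1 - w * t) * x))" by (simp only:)
  moreover have "- ((1 - t) ^ Suc k - x) = x - (1 - t) ^ Suc k" by simp
  moreover have "- ((1 - t) ^ Suc k - (1 - w * t) * x) = x - (1 - t) ^ Suc k - x * w * t"
    by (simp add: algebra_simps)
  ultimately show "word_series (\<le>) 1 v (Suc k) * (x - (1 - t) ^ Suc k) =
      word_series (\<le>) 1 v k * (x - (1 - t) ^ Suc k - x * w * t)"
    by (simp only: mult_minus_right[symmetric])
  have "swap_fps (1 - ?b) = w * t"
    unfolding swap_fps_minus[of 1 ?b] b by (simp add: swap_fps_1)
  with perm_series_mult[OF eq]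
  show "perm_series (\<le>) 1 v k * ((1 - t) ^ Suc k - x) = w * t * word_series (\<le>) 1 v k"
    unfolding den by simp
qed

text \<open>After the exchange of variables, 1 - (1 - vt)(1 - t)^k x is the denominator occurring in
  the second formula.\<close>

lemma series_gt:
  fixes v :: "'a::field"
  defines "t \<equiv> fps_X :: 'a fps fps" and "x \<equiv> fps_const fps_X" and "w \<equiv> fps_const (fps_const v)"
  shows "word_series (>) (-1) v (Suc k) * (x * (1 - t) ^ k * (w * t - 1) + 1) =
      word_series (>) (-1) v k * (1 - x * (1 - t) ^ k)"
    and "perm_series (>) (-1) v k * (x * (1 - t) ^ k * (w * t - 1) + 1) =
      - (w * t * (1 - t) ^ k * word_series (>) (-1) v k)"
proof -
  let ?Z = "\<lambda>k. Abs_fps (word_gf (>) (-1) v k)"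
  let ?d = "fps_const ((1 - fps_X) ^ k) :: 'a fps fps"
  let ?b = "1 - fps_const (fps_const v * fps_X) :: 'a fps fps"
  have eq: "?Z (Suc k) * (1 - ?b * ?d * fps_X) = ?Z k * (1 - ?d * fps_X)"
    using word_series_gt[of v k] by (simp flip: fps_const_1_eq_1)
  have d: "swap_fps ?d = (1 - t) ^ k"
    unfolding t_def fps_const_power[symmetric] fps_const_sub[symmetric] fps_const_1_eq_1
    by (simp only: swap_fps_simps)
  have b: "swap_fps ?b = 1 - w * t"
    unfolding t_def w_def fps_const_mult[symmetric] by (simp only: swap_fps_simps)
  have den: "swap_fps (1 - ?b * ?d * fps_X) = x * (1 - t) ^ k * (w * t - 1) + 1"
    by (simp only: swap_fps_minus[of 1 "_ * fps_X"] swap_fps_mult d b swap_fps_X swap_fps_1)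
      (simp add: x_def algebra_simps)
  have num: "swap_fps (1 - ?d * fps_X) = 1 - x * (1 - t) ^ k"
    by (simp only: swap_fps_minus[of 1 "_ * fps_X"] swap_fps_mult d swap_fps_X swap_fps_1)
      (simp add: x_def algebra_simps)
  have "swap_fps (?Z (Suc k) * (1 - ?b * ?d * fps_X)) = swap_fps (?Z k * (1 - ?d * fps_X))"
    by (simp only: eq)
  thus "word_series (>) (-1) v (Suc k) * (x * (1 - t) ^ k * (w * t - 1) + 1) =
      word_series (>) (-1) v k * (1 - x * (1 - t) ^ k)"
    unfolding swap_fps_mult[of "Abs_fps _"] den num word_series_def .
  have "swap_fps (?b * ?d - ?d) = - (w * t * (1 - t) ^ k)"
    by (simp only: swap_fps_minus[of "_ * _"] swap_fps_mult d b) (simp add: algebra_simps)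
  with perm_series_mult[OF eq]
  show "perm_series (>) (-1) v k * (x * (1 - t) ^ k * (w * t - 1) + 1) =
      - (w * t * (1 - t) ^ k * word_series (>) (-1) v k)"
    unfolding den by simp
qed

section \<open>Inverses and product formulas\<close>

lemma fps_mult_inverse_unit:
  fixes f :: "'a::{comm_ring_1,inverse} fps"
  assumes "f $ 0 * inverse (f $ 0) = 1"
  shows "f * inverse f = 1"
  using fps_right_inverse[OF assms] by (simp add: fps_inverse_def)

text \<open>The unit criterion is applied first to the inner variable over the field, then to the
  outer one.\<close>

lemma fps2_mult_inverse:
  fixes f :: "'a::field fps fps"
  assumes "f $ 0 $ 0 \<noteq> 0"
  shows "f * inverse f = 1"
  by (intro fps_mult_inverse_unit inverse_mult_eq_1' assms)

text \<open>A nonzero constant has subdegree 0, so the division involves no shift.\<close>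

lemma fps_divide_const:
  fixes f :: "'a::{comm_ring_1,inverse} fps"
  assumes "c \<noteq> 0"
  shows "f / fps_const c = f * fps_const (inverse c)"
  using assms by (simp add: fps_divide_def fps_const_inverse)

lemma word_series_le_prod:
  fixes v :: "'a::field"
  defines "t \<equiv> fps_X :: 'a fps fps" and "x \<equiv> fps_const fps_X" and "w \<equiv> fps_const (fps_const v)"
  shows "word_series (\<le>) 1 v k =
    (\<Prod>i = 1..k. (x - (1 - t) ^ i - x * w * t) * inverse (x - (1 - t) ^ i))"
proof (induction k)
  case (Suc k)
  have "(x - (1 - t) ^ Suc k) * inverse (x - (1 - t) ^ Suc k) = 1"
    by (rule fps2_mult_inverse) (simp add: t_def x_def fps_power_zeroth)
  hence "word_series (\<le>) 1 v (Suc k) =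
    word_series (\<le>) 1 v (Suc k) * (x - (1 - t) ^ Suc k) * inverse (x - (1 - t) ^ Suc k)"
    by (simp only: mult.assoc mult_1_right)
  also have "\<dots> = word_series (\<le>) 1 v k *
      ((x - (1 - t) ^ Suc k - x * w * t) * inverse (x - (1 - t) ^ Suc k))"
    unfolding t_def x_def w_def series_le(1) by (rule mult.assoc)
  finally show ?case unfolding Suc by simp
qed (simp add: word_series_0)

lemma word_series_gt_prod:
  fixes v :: "'a::field"
  defines "t \<equiv> fps_X :: 'a fps fps" and "x \<equiv> fps_const fps_X" and "w \<equiv> fps_const (fps_const v)"
  shows "word_series (>) (-1) v k =
    (\<Prod>i = 1..k. (1 - x * (1 - t) ^ (i - 1)) * inverse (x * (1 - t) ^ (i - 1) * (w * t - 1) + 1))"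
proof (induction k)
  case (Suc k)
  let ?e = "x * (1 - t) ^ k * (w * t - 1) + 1"
  have "?e * inverse ?e = 1"
    by (rule fps2_mult_inverse) (simp add: t_def x_def w_def fps_mult_nth_0 fps_power_zeroth)
  hence "word_series (>) (-1) v (Suc k) = word_series (>) (-1) v (Suc k) * ?e * inverse ?e"
    by (simp only: mult.assoc mult_1_right)
  also have "\<dots> = word_series (>) (-1) v k * ((1 - x * (1 - t) ^ k) * inverse ?e)"
    unfolding t_def x_def w_def series_gt(1) by (rule mult.assoc)
  finally show ?case unfolding Suc by simp
qed (simp add: word_series_0)

text \<open>Coefficient n of the partial sums is stable after n + 1 terms. The shift
  \<open>d\<close> will be 0 for the expansion in u and 1 for its inverse, whose exponents start at
  1.\<close>

lemma sums_fps_shifted: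
  "(\<lambda>m. fps_const (a m) * fps_X ^ (m + d)) sums (fps_X ^ d * Abs_fps a :: 'a::comm_ring_1 fps)"
  unfolding sums_def
proof (rule tendsto_fpsI)
  fix n
  show "\<forall>\<^sub>F N in sequentially. (\<Sum>m<N. fps_const (a m) * fps_X ^ (m + d)) $ n = (fps_X ^ d * Abs_fps a) $ n"
    unfolding eventually_sequentially
  proof (intro exI allI impI)
    fix N assume N: "Suc n \<le> N"
    have "(\<Sum>m<N. fps_const (a m) * fps_X ^ (m + d)) $ n = (\<Sum>m<N. if n = m + d then a m else 0)"
      by (simp add: fps_sum_nth fps_X_power_iff if_distrib cong: if_cong)
    also have "\<dots> = (\<Sum>m<N. if m = n - d then (if d \<le> n then a m else 0) else 0)"
      by (rule sum.cong) auto
    also have "\<dots> = (fps_X ^ d * Abs_fps a) $ n"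
      using N by (subst sum.delta) (auto simp: fps_X_power_mult_nth)
    finally show "(\<Sum>m<N. fps_const (a m) * fps_X ^ (m + d)) $ n = (fps_X ^ d * Abs_fps a) $ n" .
  qed
qed

section \<open>Coefficients as sums over permutations\<close>

lemma perm_series_nth:
  fixes v :: "'a::comm_ring_1"
  assumes R: "R = (\<le>) \<or> R = (>)" and n: "0 < n"
  defines "b \<equiv> \<lambda>k p. of_nat (blocks R k (map p [1..<Suc n])) :: 'a"
    and "c \<equiv> \<lambda>l p. of_nat (card (labels n (inv p) l)) :: 'a"
  shows "perm_series R s v k $ n $ l =
    (\<Sum>p | p permutes {1..n}. s ^ n * v ^ rmax n p * (b (Suc k) p - b k p) * (c (Suc l) p - c l p))"
proof -
  \<comment> \<open>Words with largest letter at most \<open>l\<close> come from labellings bounded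
    by \<open>l\<close>. A difference in \<open>l\<close> then isolates the largest letter l + 1,
    and a difference in \<open>k\<close> yields \<open>perm_series\<close>.\<close>
  have W: "(\<Sum>m\<le>l. word_gf R s v k m $ n) =
    (\<Sum>p | p permutes {1..n}. s ^ n * v ^ rmax n p * b k p * c l p)" for k l
    using sum_permutations_conv_words[OF R, where n = n and v = v and k = k and l = l, symmetric]
    by (simp add: word_gf_def b_def c_def sum_distrib_left[symmetric] mult.assoc del: upt_Suc)
  have "word_gf R s v k (Suc l) $ n =
    (\<Sum>p | p permutes {1..n}. s ^ n * v ^ rmax n p * b k p * (c (Suc l) p - c l p))" for k
    using W[of k "Suc l"] W[of k l] by (simp add: algebra_simps sum_subtractf)
  hence "perm_series R s v k $ n $ l =
    (\<Sum>p | p permutes {1..n}. s ^ n * v ^ rmax n p * b (Suc k) p * (c (Suc l) p - c l p)) -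
    (\<Sum>p | p permutes {1..n}. s ^ n * v ^ rmax n p * b k p * (c (Suc l) p - c l p))"
    by (simp add: perm_series_def)
  also have "\<dots> = (\<Sum>p | p permutes {1..n}. s ^ n * v ^ rmax n p * (b (Suc k) p - b k p) * (c (Suc l) p - c l p))"
    unfolding sum_subtractf[symmetric] by (simp add: algebra_simps)
  finally show ?thesis .
qed

lemma mult_power_shift:
  fixes a b x y :: "'a::comm_semiring_1"
  assumes "x * a = y * b"
  shows "x * (y ^ n * a) = y ^ Suc n * b"
proof -
  have "x * (y ^ n * a) = y ^ n * (y * b)" unfolding assms[symmetric] by (rule mult.left_commute)
  thus ?thesis by (simp only: power_Suc2 mult.assoc)
qed

lemma mult_regroup:
  fixes a b c p q :: "'a::comm_semiring_1"
  shows "a * (b * c) * (p * q) = a * ((p * b) * (q * c))"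
  by (simp only: mult_ac)

text \<open>Differencing a sequence that starts with 0 multiplies its series by (1 - X)/X. In the
  series of \<open>blocks\<close> and of \<open>labels\<close> this lowers the exponents of X and of
  the denominator 1 - X by one each; the denominators are kept on the left.\<close>

lemma perm_series_key:
  fixes v :: "'a::field"
  assumes R: "R = (\<le>) \<or> R = (>)" and n: "0 < n"
  shows "Abs_fps (\<lambda>k. perm_series R s v k $ n) * ((1 - fps_X) ^ n * fps_const ((1 - fps_X) ^ n)) =
    (\<Sum>p | p permutes {1..n}. fps_const (fps_const (s ^ n * v ^ rmax n p)) *
       (fps_X ^ breaks R (map p [1..<Suc n]) * fps_const (fps_X ^ ides n p)))"
proof -
  define B where "B = (\<lambda>p. Abs_fps (\<lambda>k. of_nat (blocks R (Suc k) (map p [1..<Suc n])) -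
    of_nat (blocks R k (map p [1..<Suc n]))) :: 'a fps fps)"
  define C where "C = (\<lambda>p. Abs_fps (\<lambda>l. of_nat (card (labels n (inv p) (Suc l))) -
    of_nat (card (labels n (inv p) l))) :: 'a fps)"
  have B: "(1 - fps_X) ^ n * B p = fps_X ^ breaks R (map p [1..<Suc n])" for p
  proof -
    let ?w = "map p [1..<Suc n]"
    let ?G = "Abs_fps (\<lambda>k. of_nat (blocks R k ?w)) :: 'a fps fps"
    have w: "?w \<noteq> []" "length ?w = n" using n by (simp_all del: upt_Suc)
    obtain a u where au: "?w = a # u" using w(1) by (cases ?w) auto
    \<comment> \<open>As n > 0, the word is nonempty and cannot be cut into 0 blocks, so the series
      of block counts starts with 0.\<close>
    have "fps_X * B p = (1 - fps_X) * ?G"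
    proof (rule fps_ext)
      fix k show "(fps_X * B p) $ k = ((1 - fps_X) * ?G) $ k"
        by (cases k) (simp_all add: B_def fps_one_minus_X_mult_nth au del: upt_Suc One_nat_def)
    qed
    hence "fps_X * ((1 - fps_X) ^ n * B p) = (1 - fps_X) ^ Suc (length ?w) * ?G"
      unfolding w(2) by (rule mult_power_shift)
    also have "\<dots> = fps_X ^ Suc (breaks R ?w)"
      unfolding blocks_gf using w(1) by (simp only: if_False)
    finally show ?thesis by (simp del: upt_Suc)
  qed
  have C: "(1 - fps_X) ^ n * C p = fps_X ^ ides n p" for p
  proof -
    let ?G = "Abs_fps (\<lambda>l. of_nat (card (labels n (inv p) l))) :: 'a fps"
    \<comment> \<open>Likewise, there are no labels between 1 and 0.\<close>
    have "fps_X * C p = (1 - fps_X) * ?G"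
    proof (rule fps_ext)
      fix l show "(fps_X * C p) $ l = ((1 - fps_X) * ?G) $ l"
        using n by (cases l; cases n)
          (simp_all add: C_def fps_one_minus_X_mult_nth card_labels_Suc_0)
    qed
    hence "fps_X * ((1 - fps_X) ^ n * C p) = (1 - fps_X) ^ Suc n * ?G"
      by (rule mult_power_shift)
    also have "\<dots> = fps_X ^ Suc (ides n p)"
      unfolding labels_series ides_def using n by simp
    finally show ?thesis by simp
  qed
  have 1: "Abs_fps (\<lambda>k. perm_series R s v k $ n) =
    (\<Sum>p | p permutes {1..n}. fps_const (fps_const (s ^ n * v ^ rmax n p)) * (B p * fps_const (C p)))"
  proof (rule fps2_eqI)
    fix k l
    have "B p $ k = fps_const (of_nat (blocks R (Suc k) (map p [1..<Suc n])) -
        of_nat (blocks R k (map p [1..<Suc n])))" for p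
      by (simp add: B_def del: upt_Suc flip: fps_of_nat)
    hence "(fps_const (fps_const a) * (B p * fps_const (C p))) $ k $ l =
        a * (of_nat (blocks R (Suc k) (map p [1..<Suc n])) - of_nat (blocks R k (map p [1..<Suc n]))) * C p $ l" for a p
      by (simp add: mult.assoc del: upt_Suc)
    thus "Abs_fps (\<lambda>k. perm_series R s v k $ n) $ k $ l =
      (\<Sum>p | p permutes {1..n}. fps_const (fps_const (s ^ n * v ^ rmax n p)) * (B p * fps_const (C p))) $ k $ l"
      unfolding fps_sum_nth fps_nth_Abs_fps perm_series_nth[OF R n] by (simp only: C_def fps_nth_Abs_fps)
  qed
  have 2: "(\<Sum>p | p permutes {1..n}. fps_const (fps_const (s ^ n * v ^ rmax n p)) * (B p * fps_const (C p))) *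
      ((1 - fps_X) ^ n * fps_const ((1 - fps_X) ^ n)) =
    (\<Sum>p | p permutes {1..n}. fps_const (fps_const (s ^ n * v ^ rmax n p)) *
       (((1 - fps_X) ^ n * B p) * fps_const ((1 - fps_X) ^ n * C p)))"
    unfolding sum_distrib_right fps_const_mult[symmetric, of "(1 - fps_X) ^ n"]
    by (intro sum.cong refl mult_regroup)
  show ?thesis unfolding 1 2 B C ..
qed

lemma perm_series_0: "perm_series R s v k $ 0 = 0"
  by (rule fps_ext) (simp add: perm_series_def word_gf_def words_0_left)

section \<open>Laurent expansions\<close>

text \<open>The embedding implicit in \<open>expands_to\<close>: the outer variable becomes y and
  the inner one x. It is shown to respect the ring operations.\<close>

definition fls2_of_fps2 :: "'a::comm_ring_1 fps fps \<Rightarrow> 'a fls fls" where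
  "fls2_of_fps2 f = fps_to_fls (Abs_fps (\<lambda>k. fps_to_fls (f $ k)))"

lemma fps_to_fls_sum: "fps_to_fls (sum f A) = (\<Sum>x\<in>A. fps_to_fls (f x :: 'a::comm_ring_1 fps))"
  by (induction A rule: infinite_finite_induct) simp_all

lemma fls2_of_fps2_mult: "fls2_of_fps2 (f * g) = fls2_of_fps2 f * fls2_of_fps2 g"
proof -
  have "Abs_fps (\<lambda>k. fps_to_fls ((f * g) $ k)) =
    Abs_fps (\<lambda>k. fps_to_fls (f $ k)) * Abs_fps (\<lambda>k. fps_to_fls (g $ k))"
    by (rule fps_ext) (simp add: fps_mult_nth fps_to_fls_sum fls_times_fps_to_fls)
  thus ?thesis by (simp add: fls2_of_fps2_def fls_times_fps_to_fls)
qed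

lemma fls2_of_fps2_add: "fls2_of_fps2 (f + g) = fls2_of_fps2 f + fls2_of_fps2 g"
proof -
  have "Abs_fps (\<lambda>k. fps_to_fls ((f + g) $ k)) =
    Abs_fps (\<lambda>k. fps_to_fls (f $ k)) + Abs_fps (\<lambda>k. fps_to_fls (g $ k))"
    by (rule fps_ext) simp
  thus ?thesis by (simp add: fls2_of_fps2_def)
qed

lemma fls2_of_fps2_minus: "fls2_of_fps2 (f - g) = fls2_of_fps2 f - fls2_of_fps2 g"
  using fls2_of_fps2_add[of "f - g" g] by simp

lemma fls2_of_fps2_const: "fls2_of_fps2 (fps_const a) = fls_const (fps_to_fls a)"
proof -
  have "Abs_fps (\<lambda>k. fps_to_fls (fps_const a $ k)) = fps_const (fps_to_fls a)"
    by (rule fps_ext) simp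
  thus ?thesis by (simp add: fls2_of_fps2_def)
qed

lemma fls2_of_fps2_1: "fls2_of_fps2 1 = 1"
  using fls2_of_fps2_const[of 1] by simp

lemma fls2_of_fps2_0: "fls2_of_fps2 0 = 0"
  using fls2_of_fps2_const[of 0] by simp

lemma fls2_of_fps2_X: "fls2_of_fps2 fps_X = fls_X"
proof -
  have "Abs_fps (\<lambda>k. fps_to_fls (fps_X $ k)) = (fps_X :: 'a fls fps)"
    by (rule fps_ext) simp
  thus ?thesis by (simp add: fls2_of_fps2_def)
qed

lemma fls2_of_fps2_power: "fls2_of_fps2 (f ^ n) = fls2_of_fps2 f ^ n"
  by (induction n) (simp_all add: fls2_of_fps2_1 fls2_of_fps2_mult)

lemma fls2_of_fps2_sum: "fls2_of_fps2 (sum f A) = (\<Sum>x\<in>A. fls2_of_fps2 (f x))"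
  by (induction A rule: infinite_finite_induct) (simp_all add: fls2_of_fps2_0 fls2_of_fps2_add)

lemma lau_x_neq_1: "lau_x \<noteq> 1"
proof
  assume "lau_x = 1"
  hence "fls_nth (fls_nth lau_x 0) 0 = fls_nth (fls_nth 1 0) (0::int)" by simp
  thus False by (simp add: lau_x_def)
qed

lemma lau_y_neq_1: "lau_y \<noteq> 1"
proof
  assume "lau_y = 1"
  hence "fls_nth lau_y 0 = fls_nth 1 (0::int)" by simp
  thus False by (simp add: lau_y_def)
qed

lemma lau_y_neq_0: "lau_y \<noteq> 0"
  by (simp add: lau_y_def)

text \<open>The embedding carries \<open>perm_series_key\<close> into a field, where the
  denominators can be divided out because x and y differ from 1.\<close>

lemma perm_series_laurent:
  assumes R: "R = (\<le>) \<or> R = (>)" and n: "0 < n"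
  shows "fls2_of_fps2 (Abs_fps (\<lambda>k. perm_series R s scal_v k $ n)) =
    (\<Sum>p | p permutes {1..n}. fls_const (fls_const s) ^ n * lau_y ^ breaks R (map p [1..<Suc n]) *
       lau_x ^ ides n p * lau_v ^ rmax n p / ((1 - lau_y) ^ n * (1 - lau_x) ^ n))"
proof -
  have c: "fls2_of_fps2 (fps_const (fps_const a)) = fls_const (fls_const a)" for a :: scal
    by (simp add: fls2_of_fps2_const)
  have x: "fls2_of_fps2 (fps_const fps_X) = lau_x" by (simp add: fls2_of_fps2_const lau_x_def)
  have "fls2_of_fps2 (Abs_fps (\<lambda>k. perm_series R s scal_v k $ n)) * ((1 - lau_y) ^ n * (1 - lau_x) ^ n) =
    fls2_of_fps2 (Abs_fps (\<lambda>k. perm_series R s scal_v k $ n) * ((1 - fps_X) ^ n * fps_const ((1 - fps_X) ^ n)))"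
    by (simp only: fps_const_power[symmetric] fps_const_sub[symmetric] fps_const_1_eq_1
        fls2_of_fps2_mult fls2_of_fps2_power fls2_of_fps2_minus fls2_of_fps2_1 fls2_of_fps2_X x lau_y_def)
  also have "\<dots> = (\<Sum>p | p permutes {1..n}. fls_const (fls_const s) ^ n * lau_y ^ breaks R (map p [1..<Suc n]) *
       lau_x ^ ides n p * lau_v ^ rmax n p)"
    unfolding perm_series_key[OF R n] fls2_of_fps2_sum
  proof (rule sum.cong[OF refl])
    fix p
    show "fls2_of_fps2 (fps_const (fps_const (s ^ n * scal_v ^ rmax n p)) *
        (fps_X ^ breaks R (map p [1..<Suc n]) * fps_const (fps_X ^ ides n p))) =
      fls_const (fls_const s) ^ n * lau_y ^ breaks R (map p [1..<Suc n]) *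
       lau_x ^ ides n p * lau_v ^ rmax n p"
      by (simp only: fps_const_power[symmetric] fps_const_mult[symmetric]
        fls2_of_fps2_mult fls2_of_fps2_power fls2_of_fps2_X c x lau_y_def lau_v_def) (simp only: mult_ac)
  qed
  finally have "fls2_of_fps2 (Abs_fps (\<lambda>k. perm_series R s scal_v k $ n)) =
     (\<Sum>p | p permutes {1..n}. fls_const (fls_const s) ^ n * lau_y ^ breaks R (map p [1..<Suc n]) *
       lau_x ^ ides n p * lau_v ^ rmax n p) / ((1 - lau_y) ^ n * (1 - lau_x) ^ n)"
    using lau_x_neq_1 lau_y_neq_1 by (simp add: eq_divide_eq del: upt_Suc)
  thus ?thesis by (simp only: sum_divide_distrib)
qed

section \<open>Expansion in u and in its inverse\<close>

lemma expands_to_alt: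
  "expands_to g h \<longleftrightarrow> (\<forall>n. g $ n = fls2_of_fps2 (Abs_fps (\<lambda>k. h $ k $ n)))"
  by (simp add: expands_to_def fls2_of_fps2_def)

lemma expands_to_le:
  "expands_to (perm_gf lau_x lau_y lau_v 1 1) (Abs_fps (perm_series (\<le>) 1 scal_v))"
  unfolding expands_to_alt
proof
  fix n
  show "perm_gf lau_x lau_y lau_v 1 1 $ n =
    fls2_of_fps2 (Abs_fps (\<lambda>k. Abs_fps (perm_series (\<le>) 1 scal_v) $ k $ n))"
  proof (cases "n = 0")
    case True
    have "Abs_fps (\<lambda>k. 0) = (0 :: scal fps fps)" by (rule fps_ext) simp
    thus ?thesis using True by (simp add: perm_gf_def perm_series_0 fls2_of_fps2_0)
  next
    case False
    thus ?thesis
      by (simp add: perm_gf_def perm_series_laurent breaks_le_conv_des del: upt_Suc One_nat_def)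
  qed
qed

text \<open>From 1 - 1/y = -(1 - y)/y. For \<open>k\<close> descents and \<open>b\<close>
  non-descents, n - k = b + 1; so the exponent becomes the number of breaks for \<open>(>)\<close>,
  up to one extra factor y, and the sign (-1)^n appears.\<close>

lemma divide_inverse_parameter:
  fixes y :: "'a::field"
  assumes "y \<noteq> 0" "n = Suc (b + k)"
  shows "inverse y ^ k * c * d / ((1 - inverse y) ^ n * e) = y * ((-1) ^ n * y ^ b * c * d / ((1 - y) ^ n * e))"
proof -
  have y: "inverse y ^ k = y * y ^ b / y ^ n"
    using assms by (simp add: field_simps power_add)
  have "1 - inverse y = (-1) * (1 - y) / y" using assms(1) by (simp add: field_simps)
  hence z: "(1 - inverse y) ^ n = (-1) ^ n * (1 - y) ^ n / y ^ n"
    by (simp only: power_mult_distrib power_divide)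
  show ?thesis unfolding y z using assms(1)
    by (cases "even n") (simp_all add: mult_ac)
qed

text \<open>The parameter s = -1 absorbs the sign, and \<open>fps_X\<close> is the extra factor
  y.\<close>

lemma expands_to_gt:
  "expands_to (perm_gf lau_x (inverse lau_y) lau_v 1 1)
     (fps_X * Abs_fps (perm_series (>) (-1) scal_v))"
  unfolding expands_to_alt
proof
  fix n
  have X: "Abs_fps (\<lambda>k. (fps_X * Abs_fps (perm_series (>) (-1) scal_v)) $ k $ n) =
    fps_X * Abs_fps (\<lambda>k. perm_series (>) (-1) scal_v k $ n)"
    by (rule fps_ext) simp
  show "perm_gf lau_x (inverse lau_y) lau_v 1 1 $ n =
    fls2_of_fps2 (Abs_fps (\<lambda>k. (fps_X * Abs_fps (perm_series (>) (-1) scal_v)) $ k $ n))"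
  proof (cases "n = 0")
    case True
    have "Abs_fps (\<lambda>k. 0) = (0 :: scal fps fps)" by (rule fps_ext) simp
    thus ?thesis using True unfolding X by (simp add: perm_gf_def perm_series_0 fls2_of_fps2_0)
  next
    case False
    have "inverse lau_y ^ des n p * c * d / ((1 - inverse lau_y) ^ n * e) =
        lau_y * (fls_const (fls_const (-1)) ^ n * lau_y ^ breaks (>) (map p [1..<Suc n]) * c * d /
          ((1 - lau_y) ^ n * e))" for p c d e
    proof -
      have "n = Suc (breaks (>) (map p [1..<Suc n]) + des n p)" using breaks_gt_conv_des[of p n] False by simp
      from divide_inverse_parameter[OF lau_y_neq_0 this] show ?thesis
        unfolding fls_const_uminus fls_const_1 .
    qed
    thus ?thesis using False
      unfolding X fls2_of_fps2_mult fls2_of_fps2_X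
      by (simp add: perm_gf_def perm_series_laurent sum_distrib_left lau_y_def[symmetric] del: upt_Suc One_nat_def)
  qed
qed

section \<open>The two formulas\<close>

lemma fps_const_prod: "(\<Prod>i\<in>A. fps_const (f i)) = fps_const (\<Prod>i\<in>A. f i :: 'a::comm_ring_1)"
  by (induction A rule: infinite_finite_induct) simp_all

lemma eq_mult_inverseI:
  fixes a b c d :: "'a::comm_ring_1"
  assumes "a * b = d" "b * c = 1"
  shows "a = d * c"
  using assms by (metis mult.assoc mult_1_right)

text \<open>Apart from the power of u, everything is constant in the outer variable, so the
  quotients are taken among series in t and x, where the denominators are units with constant term 1
  or -1.\<close>

lemma term_le:
  defines "t \<equiv> fps_X :: scal fps fps" and "x \<equiv> fps_const fps_X :: scal fps fps" and "w \<equiv> fps_const (fps_const scal_v)"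
  shows "ser_v * ser_t * ser_y ^ k / ((1 - ser_t) ^ Suc k - ser_x) *
      (\<Prod>i = 1..k. (ser_x - (1 - ser_t) ^ i - ser_x * ser_v * ser_t) / (ser_x - (1 - ser_t) ^ i)) =
    fps_const (perm_series (\<le>) 1 scal_v k) * fps_X ^ k"
proof -
  have nz: "(1 - t) ^ i - x \<noteq> 0" and nz': "x - (1 - t) ^ i \<noteq> 0" for i
  proof -
    have "((1 - t) ^ i - x) $ 0 $ 0 \<noteq> 0" by (simp add: t_def x_def fps_power_zeroth)
    thus "(1 - t) ^ i - x \<noteq> 0" by force
    thus "x - (1 - t) ^ i \<noteq> 0" by simp
  qed
  have ser: "ser_v = fps_const w" "ser_t = fps_const t" "ser_x = fps_const x" "ser_y = fps_X"
    by (simp_all add: ser_v_def ser_t_def ser_x_def ser_y_def w_def t_def x_def)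
  have den: "(1 - ser_t) ^ i - ser_x = fps_const ((1 - t) ^ i - x)"
    and den': "ser_x - (1 - ser_t) ^ i = fps_const (x - (1 - t) ^ i)"
    and num: "ser_x - (1 - ser_t) ^ i - ser_x * ser_v * ser_t = fps_const (x - (1 - t) ^ i - x * w * t)" for i
    unfolding ser fps_const_1_eq_1[symmetric]
    by (simp_all only: fps_const_sub fps_const_power fps_const_mult)
  have "((1 - t) ^ Suc k - x) * inverse ((1 - t) ^ Suc k - x) = 1"
    by (rule fps2_mult_inverse) (simp add: t_def x_def fps_power_zeroth)
  from eq_mult_inverseI[OF series_le(2)[of scal_v k, folded t_def x_def w_def] this]
  have P: "perm_series (\<le>) 1 scal_v k = w * t * word_series (\<le>) 1 scal_v k * inverse ((1 - t) ^ Suc k - x)" .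
  show ?thesis
    unfolding num unfolding den den' unfolding fps_divide_const[OF nz] fps_divide_const[OF nz'] P
      word_series_le_prod[of scal_v k, folded t_def x_def w_def] fps_const_mult[symmetric] fps_const_prod[symmetric]
    unfolding ser
    by (simp only: mult_ac)
qed

lemma term_gt:
  defines "t \<equiv> fps_X :: scal fps fps" and "x \<equiv> fps_const fps_X :: scal fps fps" and "w \<equiv> fps_const (fps_const scal_v)"
  shows "ser_y ^ Suc k * (ser_v * ser_t * (1 - ser_t) ^ k / (ser_x * (1 - ser_t) ^ k - 1)) *
      (\<Prod>i = 1..Suc k. (1 - ser_x * (1 - ser_t) ^ (i - 1)) /
        (ser_x * (1 - ser_t) ^ (i - 1) * (ser_v * ser_t - 1) + 1)) =
    fps_const (perm_series (>) (-1) scal_v k) * fps_X ^ Suc k"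
proof -
  \<comment> \<open>\<open>f\<close> and \<open>e\<close> are the numerators and denominators of the
    product in the second formula, indexed from 0; the denominator of the prefactor is - f
    k.\<close>
  define f where "f = (\<lambda>i. 1 - x * (1 - t) ^ i)"
  define e where "e = (\<lambda>i. x * (1 - t) ^ i * (w * t - 1) + 1)"
  have f: "- f i * inverse (- f i) = 1" for i
    by (rule fps2_mult_inverse) (simp add: f_def t_def x_def fps_power_zeroth fps_mult_nth_0)
  have e: "e i * inverse (e i) = 1" for i
    by (rule fps2_mult_inverse) (simp add: e_def w_def t_def x_def fps_power_zeroth fps_mult_nth_0)
  have nz: "- f i \<noteq> 0" "e i \<noteq> 0" for i using f[of i] e[of i] by force+
  have ser: "ser_v = fps_const w" "ser_t = fps_const t" "ser_x = fps_const x" "ser_y = fps_X"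
    by (simp_all add: ser_v_def ser_t_def ser_x_def ser_y_def w_def t_def x_def)
  have den: "ser_x * (1 - ser_t) ^ i - 1 = fps_const (- f i)"
    and num: "1 - ser_x * (1 - ser_t) ^ i = fps_const (f i)"
    and den': "ser_x * (1 - ser_t) ^ i * (ser_v * ser_t - 1) + 1 = fps_const (e i)"
    and c: "(1 - ser_t) ^ i = fps_const ((1 - t) ^ i)" for i
    unfolding ser fps_const_1_eq_1[symmetric] f_def e_def
    by (simp_all only: fps_const_sub fps_const_power fps_const_mult fps_const_add minus_diff_eq)
  have "perm_series (>) (-1) scal_v k = - (w * t * (1 - t) ^ k * word_series (>) (-1) scal_v k) * inverse (e k)"
    unfolding e_def
    by (rule eq_mult_inverseI[OF series_gt(2)[of scal_v k, folded t_def x_def w_def] e[unfolded e_def]])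
  \<comment> \<open>The inserted unit supplies the last numerator f k of the product and the
    denominator - f k of the prefactor, and its sign cancels the leading minus.\<close>
  also have "\<dots> = - (w * t * (1 - t) ^ k * word_series (>) (-1) scal_v k) * inverse (e k) * (- f k * inverse (- f k))"
    by (simp only: f mult_1_right)
  also have "\<dots> = w * t * (1 - t) ^ k * inverse (- f k) * (word_series (>) (-1) scal_v k * (f k * inverse (e k)))"
    by (simp add: mult_ac)
  also have "word_series (>) (-1) scal_v k = (\<Prod>i = 1..k. f (i - 1) * inverse (e (i - 1)))"
    unfolding word_series_gt_prod[of scal_v k, folded t_def x_def w_def] f_def e_def ..
  also have "\<dots> * (f k * inverse (e k)) = (\<Prod>i = 1..Suc k. f (i - 1) * inverse (e (i - 1)))"
    by simp
  finally have P: "perm_series (>) (-1) scal_v k = w * t * (1 - t) ^ k * inverse (- f k) *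
     (\<Prod>i = 1..Suc k. f (i - 1) * inverse (e (i - 1)))" .
  show ?thesis
    unfolding den' num den unfolding c unfolding fps_divide_const[OF nz(1)] fps_divide_const[OF nz(2)] P
      fps_const_mult[symmetric] fps_const_prod[symmetric]
    unfolding ser
    by (simp only: mult_ac)
qed

theorem theorem2:
  shows
    "(\<exists>h :: ser. expands_to (perm_gf lau_x lau_y lau_v 1 1) h \<and>
        (let x = ser_x; t = ser_t; v = ser_v; u = ser_y in
          (\<lambda>m. let n = Suc m in
             (v * t * u ^ (n - 1)) / ((1 - t) ^ n - x) *
             (\<Prod>i = 1..n - 1. (x - (1 - t) ^ i - x * v * t) / (x - (1 - t) ^ i)))
          sums h)) \<and>
     (\<exists>h :: ser. expands_to (perm_gf lau_x (inverse lau_y) lau_v 1 1) h \<and>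
        (let x = ser_x; t = ser_t; v = ser_v; u_inv = ser_y in
          (\<lambda>m. let n = Suc m in
             u_inv ^ n * ((v * t * (1 - t) ^ (n - 1)) / (x * (1 - t) ^ (n - 1) - 1)) *
             (\<Prod>i = 1..n. (1 - x * (1 - t) ^ (i - 1)) /
                              (x * (1 - t) ^ (i - 1) * (v * t - 1) + 1)))
          sums h)) \<and>
     perm_gf rat_x rat_u rat_v 1 1 = perm_gf rat_u rat_x 1 rat_v 1 \<and>
     perm_gf rat_x rat_u rat_v 1 1 = perm_gf rat_x rat_u 1 rat_v 1 \<and>
     perm_gf rat_x rat_u rat_v 1 1 = perm_gf rat_u rat_x rat_v 1 1"
proof (intro conjI exI)
  show "let x = ser_x; t = ser_t; v = ser_v; u = ser_y in
      (\<lambda>m. let n = Suc m in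
         (v * t * u ^ (n - 1)) / ((1 - t) ^ n - x) *
         (\<Prod>i = 1..n - 1. (x - (1 - t) ^ i - x * v * t) / (x - (1 - t) ^ i)))
      sums Abs_fps (perm_series (\<le>) 1 scal_v)"
    unfolding Let_def diff_Suc_1 term_le
    using sums_fps_shifted[of "perm_series (\<le>) 1 scal_v" 0]
    by (simp only: power_0 mult_1_left add_0_right)
  \<comment> \<open>The exponents of the inverse of u start at 1, whence the factor
    \<open>fps_X\<close> in the witness.\<close>
  show "let x = ser_x; t = ser_t; v = ser_v; u_inv = ser_y in
      (\<lambda>m. let n = Suc m in
         u_inv ^ n * ((v * t * (1 - t) ^ (n - 1)) / (x * (1 - t) ^ (n - 1) - 1)) *
         (\<Prod>i = 1..n. (1 - x * (1 - t) ^ (i - 1)) /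
                          (x * (1 - t) ^ (i - 1) * (v * t - 1) + 1)))
      sums (fps_X * Abs_fps (perm_series (>) (-1) scal_v))"
    unfolding Let_def diff_Suc_1 term_gt
    using sums_fps_shifted[of "perm_series (>) (-1) scal_v" 1]
    by (simp only: power_Suc0_right add_Suc_right add_0_right One_nat_def)
  \<comment> \<open>The half turn moves the weight from \<open>lmin\<close> to \<open>rmax\<close>;
    inversion then exchanges the two descent variables.\<close>
  show "perm_gf rat_x rat_u rat_v 1 1 = perm_gf rat_u rat_x 1 rat_v 1"
    unfolding perm_gf_rev_compl by (rule perm_gf_inv)
  show "perm_gf rat_x rat_u rat_v 1 1 = perm_gf rat_x rat_u 1 rat_v 1"
    by (rule perm_gf_rev_compl[symmetric])
qed (rule expands_to_le expands_to_gt perm_gf_inv)+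

end
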